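(* Let $G,K,P=MN,V$ and the maps $\mathcal S,\mathcal S',\iota,\iota_M$ be as in the context. The diagram formed by $\mathcal S:\mathcal H(G,K,V^* )\to\mathcal H(M,M\cap K,(V^* )^{N\cap K})$, $\iota:\mathcal H(G,K,V^* )\to\mathcal H(G,K,V)^0$, $\iota_M:\mathcal H(M,M\cap K,(V^* )^{N\cap K})\to\mathcal H(M,M\cap K,V_{N\cap K})^0$ and $\mathcal S'^0:\mathcal H(G,K,V)^0\to\mathcal H(M,M\cap K,V_{N\cap K})^0$ is commutative: $$\iota_M\circ\mathcal S=\mathcal S'^0\circ\iota.$$
   Context: $C$ is any field, $G$ is a locally profinite group, $K$ an open subgroup of $G$, $P$ a closed subgroup of $G$ with $G=KP$. $P$ is the semi-direct product of a closed normal subgroup $N$ and a closed subgroup $M$, and $P\cap K$ is the semi-direct product of $N\cap K$ by $M\cap K$. Each double coset $KgK$ is the union of finitely many cosets $Kg'$ and of finitely many cosets $g''K$. $V$ is a smooth $C[K]$-module, finite dimensional over $C$; $V^*=\mathrm{Hom}_C(V,C)$ carries the contragredient action of $K$. $V_{N\cap K}$ is the space of $N\cap K$-coinvariants of $V$, $\overline v$ the image of $v\in V$ in it, and $(V_{N\cap K})^*\simeq(V^* )^{N\cap K}$ canonically. $\mathcal H(G,K,V)$ is the convolution algebra ($(\Phi*\Psi)(g)=\sum_{h\in G/K}\Phi(h)\Psi(h^{-1}g)$) of functions $\Phi:G\to\mathrm{End}_C(V)$ with $\Phi(xgx')=x\circ\Phi(g)\circ x'$ for $x,x'\in K$ and support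 a finite union of double cosets $KgK$; $\mathcal H(M,M\cap K,\cdot)$ is defined similarly. $A^0$ denotes the opposite ring of $A$, and $f^0:A^0\to B^0$ is the ring morphism given by the same map as a ring morphism $f:A\to B$. $\mathcal S':\mathcal H(G,K,V)\to\mathcal H(M,M\cap K,V_{N\cap K})$ is the algebra homomorphism $\mathcal S'(\Phi)(m)(\overline v)=\sum_{n\in(N\cap K)\backslash N}\overline{\Phi(nm)(v)}$. $\mathcal S:\mathcal H(G,K,V^* )\to\mathcal H(M,M\cap K,(V^* )^{N\cap K})$ is the (Satake) algebra homomorphism $\mathcal S(\Phi)(m)(\lambda)=\sum_{n\in N/(N\cap K)}\Phi(mn)(\lambda)$ for $\lambda\in(V^* )^{N\cap K}$. $\iota:\mathcal H(G,K,V^* )\to\mathcal H(G,K,V)^0$ is the algebra isomorphism $\iota(\Phi)(g)=(\Phi(g^{-1}))^t$ (transpose, with $V^{**}=V$), and $\iota_M:\mathcal H(M,M\cap K,(V^* )^{N\cap K})\to\mathcal H(M,M\cap K,V_{N\cap K})^0$ is defined by the same formula using $((V^* )^{N\cap K})^*\simeq V_{N\cap K}$. *)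

theory Defs
  imports
    "HOL-Algebra.AbelCoset"
    "HOL-Algebra.Left_Coset"
    "HOL-Algebra.Group_Action"
    "HOL-Algebra.Free_Abelian_Groups"
    "HOL-Analysis.T1_Spaces"
    "Jordan_Normal_Form.Missing_VectorSpace"
begin

section \<open>Locally profinite groups and semi-direct products\<close>

definition topological_group :: "('g, 'm) monoid_scheme \<Rightarrow> 'g topology \<Rightarrow> bool" where
  "topological_group G T \<longleftrightarrow>
     group G \<and> topspace T = carrier G \<and>
     continuous_map (prod_topology T T) T (\<lambda>(x, y). x \<otimes>\<^bsub>G\<^esub> y) \<and>
     continuous_map T T (\<lambda>x. inv\<^bsub>G\<^esub> x)"

definition locally_profinite_group :: "('g, 'm) monoid_scheme \<Rightarrow> 'g topology \<Rightarrow> bool" where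
  "locally_profinite_group G T \<longleftrightarrow>
     topological_group G T \<and> Hausdorff_space T \<and>
     (\<forall>U. openin T U \<and> \<one>\<^bsub>G\<^esub> \<in> U \<longrightarrow>
        (\<exists>H. subgroup H G \<and> openin T H \<and> compactin T H \<and> H \<subseteq> U))"

definition semidirect_product ::
    "('g, 'm) monoid_scheme \<Rightarrow> 'g set \<Rightarrow> 'g set \<Rightarrow> 'g set \<Rightarrow> bool" where
  "semidirect_product G P N M \<longleftrightarrow>
     subgroup P G \<and> N \<lhd> G\<lparr>carrier := P\<rparr> \<and> subgroup M (G\<lparr>carrier := P\<rparr>) \<and>
     N <#>\<^bsub>G\<^esub> M = P \<and> N \<inter> M = {\<one>\<^bsub>G\<^esub>}"

definition double_coset :: "('g, 'm) monoid_scheme \<Rightarrow> 'g set \<Rightarrow> 'g \<Rightarrow> 'g set" where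
  "double_coset G K g = K <#>\<^bsub>G\<^esub> (g <#\<^bsub>G\<^esub> K)"

section \<open>Linear maps, duals and quotients\<close>

definition lin_maps ::
    "('c, 'r) ring_scheme \<Rightarrow> ('c, 'v, 'a) module_scheme \<Rightarrow> ('c, 'w, 'b) module_scheme
      \<Rightarrow> ('v \<Rightarrow> 'w) set" where
  "lin_maps C V W = module_hom C V W \<inter> extensional (carrier V)"

definition scalar_module :: "('c, 'r) ring_scheme \<Rightarrow> ('c, 'c) module" where
  "scalar_module C =
     \<lparr>carrier = carrier C, monoid.mult = (\<otimes>\<^bsub>C\<^esub>), monoid.one = \<one>\<^bsub>C\<^esub>,
      ring.zero = \<zero>\<^bsub>C\<^esub>, ring.add = (\<oplus>\<^bsub>C\<^esub>), module.smult = (\<otimes>\<^bsub>C\<^esub>)\<rparr>"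

definition dual :: "('c, 'r) ring_scheme \<Rightarrow> ('c, 'v, 'a) module_scheme \<Rightarrow> ('c, 'v \<Rightarrow> 'c) module" where
  "dual C V = (ring.func_space C (carrier V))\<lparr>carrier := lin_maps C V (scalar_module C)\<rparr>"

definition transpose_map ::
    "('c, 'r) ring_scheme \<Rightarrow> ('c, 'w, 'a) module_scheme \<Rightarrow> ('w \<Rightarrow> 'w) \<Rightarrow> ('w \<Rightarrow> 'c) \<Rightarrow> ('w \<Rightarrow> 'c)" where
  "transpose_map C W f = (\<lambda>\<mu>\<in>carrier (dual C W). \<lambda>w\<in>carrier W. \<mu> (f w))"

text \<open>The quotient module \<open>V/U\<close>; its elements are the additive cosets of \<open>U\<close>.
  The ring multiplication and unit of a module record carry no meaning.\<close>

definition quotient_module :: "('c, 'v, 'a) module_scheme \<Rightarrow> 'v set \<Rightarrow> ('c, 'v set) module" where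
  "quotient_module V U =
     \<lparr>carrier = a_rcosets\<^bsub>V\<^esub> U, monoid.mult = (\<lambda>X Y. U), monoid.one = U, ring.zero = U,
      ring.add = (\<lambda>X Y. X <+>\<^bsub>V\<^esub> Y),
      module.smult = (\<lambda>a X. \<Union>v\<in>X. U +>\<^bsub>V\<^esub> (a \<odot>\<^bsub>V\<^esub> v))\<rparr>"

section \<open>Smooth representations, invariants and coinvariants\<close>

definition smooth_representation ::
    "('c, 'r) ring_scheme \<Rightarrow> ('g, 'm) monoid_scheme \<Rightarrow> 'g topology \<Rightarrow> 'g set
      \<Rightarrow> ('c, 'v, 'a) module_scheme \<Rightarrow> ('g \<Rightarrow> 'v \<Rightarrow> 'v) \<Rightarrow> bool" where
  "smooth_representation C G T K V \<pi> \<longleftrightarrow>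
     vectorspace C V \<and>
     group_action (G\<lparr>carrier := K\<rparr>) (carrier V) \<pi> \<and>
     (\<forall>k\<in>K. \<pi> k \<in> lin_maps C V V) \<and>
     (\<forall>v\<in>carrier V. openin (subtopology T K) (stabilizer (G\<lparr>carrier := K\<rparr>) \<pi> v))"

definition contragredient ::
    "('c, 'r) ring_scheme \<Rightarrow> ('g, 'm) monoid_scheme \<Rightarrow> ('c, 'v, 'a) module_scheme
      \<Rightarrow> ('g \<Rightarrow> 'v \<Rightarrow> 'v) \<Rightarrow> 'g \<Rightarrow> ('v \<Rightarrow> 'c) \<Rightarrow> ('v \<Rightarrow> 'c)" where
  "contragredient C G V \<pi> k =
     (\<lambda>l\<in>carrier (dual C V). \<lambda>v\<in>carrier V. l (\<pi> (inv\<^bsub>G\<^esub> k) v))"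

definition fixed_vectors ::
    "('c, 'w, 'a) module_scheme \<Rightarrow> ('g \<Rightarrow> 'w \<Rightarrow> 'w) \<Rightarrow> 'g set \<Rightarrow> ('c, 'w, 'a) module_scheme" where
  "fixed_vectors W \<rho> H = W\<lparr>carrier := {w \<in> carrier W. \<forall>h\<in>H. \<rho> h w = w}\<rparr>"

definition coinvariants_kernel ::
    "('c, 'r) ring_scheme \<Rightarrow> ('c, 'v, 'a) module_scheme \<Rightarrow> ('g \<Rightarrow> 'v \<Rightarrow> 'v) \<Rightarrow> 'g set \<Rightarrow> 'v set" where
  "coinvariants_kernel C V \<pi> H =
     module.span C V {\<pi> h v \<ominus>\<^bsub>V\<^esub> v | h v. h \<in> H \<and> v \<in> carrier V}"

definition coinvariants ::
    "('c, 'r) ring_scheme \<Rightarrow> ('c, 'v, 'a) module_scheme \<Rightarrow> ('g \<Rightarrow> 'v \<Rightarrow> 'v) \<Rightarrow> 'g set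
      \<Rightarrow> ('c, 'v set) module" where
  "coinvariants C V \<pi> H = quotient_module V (coinvariants_kernel C V \<pi> H)"

definition coinvariant_class ::
    "('c, 'r) ring_scheme \<Rightarrow> ('c, 'v, 'a) module_scheme \<Rightarrow> ('g \<Rightarrow> 'v \<Rightarrow> 'v) \<Rightarrow> 'g set
      \<Rightarrow> 'v \<Rightarrow> 'v set" where
  "coinvariant_class C V \<pi> H v = coinvariants_kernel C V \<pi> H +>\<^bsub>V\<^esub> v"

text \<open>Here and below, \<^term>\<open>the_elem (f ` X)\<close> is the common value on a coset \<open>X\<close> of a
  function \<open>f\<close> that is constant on \<open>X\<close>. In particular this is the action on coinvariants
  of a group normalizing \<open>H\<close>.\<close>

definition coinvariants_action ::
    "('c, 'r) ring_scheme \<Rightarrow> ('c, 'v, 'a) module_scheme \<Rightarrow> ('g \<Rightarrow> 'v \<Rightarrow> 'v) \<Rightarrow> 'g set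
      \<Rightarrow> 'g \<Rightarrow> 'v set \<Rightarrow> 'v set" where
  "coinvariants_action C V \<pi> H k =
     (\<lambda>X\<in>carrier (coinvariants C V \<pi> H).
        the_elem ((\<lambda>v. coinvariant_class C V \<pi> H (\<pi> k v)) ` X))"

section \<open>Hecke algebras\<close>

text \<open>The sum in \<open>W\<close> of \<open>f h\<close> over a set \<open>X\<close> of cosets, \<open>h\<close> being any representative.
  The set \<open>X\<close> may be infinite, but only finitely many terms are to be nonzero.\<close>

definition coset_sum ::
    "('c, 'w, 'a) module_scheme \<Rightarrow> ('g \<Rightarrow> 'w) \<Rightarrow> 'g set set \<Rightarrow> 'w" where
  "coset_sum W f X = gfinprod (add_monoid W) (\<lambda>c. the_elem (f ` c)) X"

definition hecke_algebra ::
    "('c, 'r) ring_scheme \<Rightarrow> ('g, 'm) monoid_scheme \<Rightarrow> 'g set \<Rightarrow> ('c, 'w, 'a) module_scheme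
      \<Rightarrow> ('g \<Rightarrow> 'w \<Rightarrow> 'w) \<Rightarrow> ('c, 'g \<Rightarrow> 'w \<Rightarrow> 'w) module" where
  "hecke_algebra C G K W \<rho> =
     \<lparr>carrier =
        {\<Phi> \<in> carrier G \<rightarrow>\<^sub>E lin_maps C W W.
           (\<forall>x\<in>K. \<forall>g\<in>carrier G. \<forall>y\<in>K.
              \<Phi> (x \<otimes>\<^bsub>G\<^esub> g \<otimes>\<^bsub>G\<^esub> y)
                = compose (carrier W) (\<rho> x) (compose (carrier W) (\<Phi> g) (\<rho> y))) \<and>
           (\<exists>F. finite F \<and> F \<subseteq> carrier G \<and>
              {g \<in> carrier G. \<Phi> g \<noteq> (\<lambda>w\<in>carrier W. \<zero>\<^bsub>W\<^esub>)} = (\<Union>g\<in>F. double_coset G K g))},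
      monoid.mult = (\<lambda>\<Phi> \<Psi>. \<lambda>g\<in>carrier G. \<lambda>w\<in>carrier W.
        coset_sum W (\<lambda>h. \<Phi> h (\<Psi> (inv\<^bsub>G\<^esub> h \<otimes>\<^bsub>G\<^esub> g) w)) (lcosets\<^bsub>G\<^esub> K)),
      monoid.one = (\<lambda>g\<in>carrier G. \<lambda>w\<in>carrier W. if g \<in> K then \<rho> g w else \<zero>\<^bsub>W\<^esub>),
      ring.zero = (\<lambda>g\<in>carrier G. \<lambda>w\<in>carrier W. \<zero>\<^bsub>W\<^esub>),
      ring.add = (\<lambda>\<Phi> \<Psi>. \<lambda>g\<in>carrier G. \<lambda>w\<in>carrier W. \<Phi> g w \<oplus>\<^bsub>W\<^esub> \<Psi> g w),
      module.smult = (\<lambda>a \<Phi>. \<lambda>g\<in>carrier G. \<lambda>w\<in>carrier W. a \<odot>\<^bsub>W\<^esub> \<Phi> g w)\<rparr>"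

definition opposite_ring :: "('a, 'b) ring_scheme \<Rightarrow> ('a, 'b) ring_scheme" where
  "opposite_ring A = A\<lparr>monoid.mult := \<lambda>x y. y \<otimes>\<^bsub>A\<^esub> x\<rparr>"

text \<open>The morphism \<open>f\<^sup>0\<close> on \<open>A\<^sup>0\<close>, given by the same map as \<open>f\<close> on \<open>A\<close>.\<close>

definition opposite_hom :: "('a, 'm) ring_scheme \<Rightarrow> ('a \<Rightarrow> 'b) \<Rightarrow> 'a \<Rightarrow> 'b" where
  "opposite_hom A f = (\<lambda>x\<in>carrier (opposite_ring A). f x)"

section \<open>The maps of the diagram\<close>

text \<open>All four maps are extensional on the carrier of the Hecke algebra they are defined on, so
  their composites are only meaningful once the inner map is known to take values in the domain
  of the outer one.\<close>

definition hecke_invariants where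
  "hecke_invariants C G K M N V \<pi> =
     hecke_algebra C (G\<lparr>carrier := M\<rparr>) (M \<inter> K)
       (fixed_vectors (dual C V) (contragredient C G V \<pi>) (N \<inter> K)) (contragredient C G V \<pi>)"

definition hecke_coinvariants where
  "hecke_coinvariants C G K M N V \<pi> =
     hecke_algebra C (G\<lparr>carrier := M\<rparr>) (M \<inter> K)
       (coinvariants C V \<pi> (N \<inter> K)) (coinvariants_action C V \<pi> (N \<inter> K))"

definition hecke_dual where
  "hecke_dual C G K V \<pi> = hecke_algebra C G K (dual C V) (contragredient C G V \<pi>)"

definition satake where
  "satake C G K M N V \<pi> =
     (\<lambda>\<Phi>\<in>carrier (hecke_dual C G K V \<pi>). \<lambda>m\<in>M.
        \<lambda>l\<in>carrier (fixed_vectors (dual C V) (contragredient C G V \<pi>) (N \<inter> K)).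
          coset_sum (dual C V) (\<lambda>n. \<Phi> (m \<otimes>\<^bsub>G\<^esub> n) l) (lcosets\<^bsub>G\<lparr>carrier := N\<rparr>\<^esub> (N \<inter> K)))"

text \<open>In \<open>satake'\<close> the individual terms depend on the vector \<open>v\<close>; only their sum depends on
  the class of \<open>v\<close> alone.\<close>

definition satake' where
  "satake' C G K M N V \<pi> =
     (\<lambda>\<Phi>\<in>carrier (hecke_algebra C G K V \<pi>). \<lambda>m\<in>M.
        \<lambda>X\<in>carrier (coinvariants C V \<pi> (N \<inter> K)).
          the_elem
            ((\<lambda>v. coset_sum (coinvariants C V \<pi> (N \<inter> K))
                (\<lambda>n. coinvariant_class C V \<pi> (N \<inter> K) (\<Phi> (n \<otimes>\<^bsub>G\<^esub> m) v))
                (rcosets\<^bsub>G\<lparr>carrier := N\<rparr>\<^esub> (N \<inter> K))) ` X))"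

text \<open>For \<open>e\<close> a linear isomorphism from \<open>W\<close> onto the dual of \<open>W'\<close>, the endomorphism of \<open>W\<close>
  corresponding to the transpose of \<open>\<Phi>(g\<^sup>-\<^sup>1)\<close>.\<close>

definition hecke_transpose where
  "hecke_transpose C G W W' e \<Phi> =
     (\<lambda>g\<in>carrier G. \<lambda>w\<in>carrier W.
        inv_into (carrier W) e (transpose_map C W' (\<Phi> (inv\<^bsub>G\<^esub> g)) (e w)))"

definition bidual_map where
  "bidual_map C V v = (\<lambda>l\<in>carrier (dual C V). l v)"

definition iota where
  "iota C G K V \<pi> =
     (\<lambda>\<Phi>\<in>carrier (hecke_dual C G K V \<pi>).
        hecke_transpose C G V (dual C V) (bidual_map C V) \<Phi>)"

text \<open>The canonical isomorphism from the coinvariants of \<open>V\<close> onto the dual of the invariants of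
  the dual of \<open>V\<close>, sending the class of \<open>v\<close> to evaluation at \<open>v\<close>.\<close>

definition coinvariants_bidual_map where
  "coinvariants_bidual_map C G V \<pi> H X =
     (\<lambda>l\<in>carrier (fixed_vectors (dual C V) (contragredient C G V \<pi>) H). the_elem (l ` X))"

definition iota_M where
  "iota_M C G K M N V \<pi> =
     (\<lambda>\<Phi>\<in>carrier (hecke_invariants C G K M N V \<pi>).
        hecke_transpose C (G\<lparr>carrier := M\<rparr>)
          (coinvariants C V \<pi> (N \<inter> K))
          (fixed_vectors (dual C V) (contragredient C G V \<pi>) (N \<inter> K))
          (coinvariants_bidual_map C G V \<pi> (N \<inter> K)) \<Phi>)"

end

theory Submission
  imports Defs
begin

text \<open>For \<open>\<Phi>\<close> in \<open>\<H>(G,K,V\<^sup>*)\<close>, \<open>m \<in> M\<close> and \<open>v \<in> V\<close>, the canonical map sends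
  \<open>\<Sum> class(\<iota>(\<Phi>)(nm)(v))\<close>, the sum being over \<open>(N \<inter> K)\n\<close>, to the functional
  \<open>\<lambda> \<mapsto> \<Sum> (\<Phi>(m\<^sup>-\<^sup>1n\<^sup>-\<^sup>1)\<lambda>)(v)\<close> on \<open>(V\<^sup>*)\<^bsup>N \<inter> K\<^esup>\<close>. Substituting \<open>n\<^sup>-\<^sup>1\<close> for \<open>n\<close>
  turns right cosets into left cosets and this into \<open>\<lambda> \<mapsto> (\<S>(\<Phi>)(m\<^sup>-\<^sup>1)\<lambda>)(v)\<close>, which is the
  transpose of \<open>\<S>(\<Phi>)(m\<^sup>-\<^sup>1)\<close> at the class of \<open>v\<close>. Since the canonical map is injective, this also
  shows that the first sum depends only on the class of \<open>v\<close>. The remaining work is to see that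
  \<open>\<S>(\<Phi>)\<close> and \<open>\<iota>(\<Phi>)\<close> lie in their Hecke algebras.\<close>

section \<open>Sums over sets of cosets\<close>

text \<open>Two features of the encoding shape the work. A coset sum is a \<open>gfinprod\<close> of
  common values: with infinitely many nonzero terms it silently becomes zero, and where the function
  is not constant on a coset the term is unspecified, so summability has to accompany every
  manipulation. Moreover all four maps are restrictions, so a composite unfolds only once the inner
  value is known to lie in a Hecke algebra, support condition included. The finiteness of double
  cosets enters twice: decomposition into cosets gK makes the sum defining S(Phi)(m) finite, and
  decomposition into cosets Kg makes the support of S(Phi) meet only finitely many cosets of M
  \<inter> K. On the linear side \<open>C\<close> is an arbitrary field and no basis is chosen.
  Injectivity comes from separating functionals, built with Zorn's lemma on subspaces; finite
  dimension yields surjectivity of V onto its bidual, by which \<open>iota\<close> acquires its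
  values. For the coinvariants, the preimage under \<open>e\<close> is exhibited directly: it is the
  coinvariant sum itself.\<close>

text \<open>Phrased with images of whole cosets, so that no representatives are chosen and a change
  of variable becomes a rewriting of images. The first conjunct also excludes the empty set from
  \<open>X\<close>.\<close>

definition coset_summable ::
    "('c, 'w, 'a) module_scheme \<Rightarrow> ('g \<Rightarrow> 'w) \<Rightarrow> 'g set set \<Rightarrow> bool" where
  "coset_summable W f X \<longleftrightarrow>
     (\<forall>c\<in>X. \<exists>w\<in>carrier W. f ` c = {w}) \<and> finite {c \<in> X. f ` c \<noteq> {\<zero>\<^bsub>W\<^esub>}}"

lemma coset_summable_the_elem:
  assumes "coset_summable W f X" "c \<in> X"
  shows "the_elem (f ` c) \<in> carrier W" "f ` c = {the_elem (f ` c)}"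
proof -
  obtain w where "w \<in> carrier W" "f ` c = {w}"
    using assms unfolding coset_summable_def by blast
  then show "the_elem (f ` c) \<in> carrier W" "f ` c = {the_elem (f ` c)}" by simp_all
qed

lemma coset_summable_finite:
  assumes "coset_summable W f X"
  shows "finite {c \<in> X. the_elem (f ` c) \<noteq> \<zero>\<^bsub>W\<^esub>}"
proof -
  have "{c \<in> X. the_elem (f ` c) \<noteq> \<zero>\<^bsub>W\<^esub>} = {c \<in> X. f ` c \<noteq> {\<zero>\<^bsub>W\<^esub>}}"
  proof (intro Collect_cong conj_cong refl)
    fix c assume "c \<in> X"
    then obtain w where "f ` c = {w}" using assms unfolding coset_summable_def by blast
    then show "(the_elem (f ` c) \<noteq> \<zero>\<^bsub>W\<^esub>) = (f ` c \<noteq> {\<zero>\<^bsub>W\<^esub>})" by simp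
  qed
  then show ?thesis using assms by (simp add: coset_summable_def)
qed

text \<open>The map \<open>\<theta>\<close> acts on the family by taking images of cosets; its
  injectivity on the family is what makes the two supports correspond.\<close>

lemma coset_summable_reindex:
  assumes "inj_on ((`) \<theta>) X"
  shows "coset_summable W f ((`) \<theta> ` X) \<longleftrightarrow> coset_summable W (f \<circ> \<theta>) X"
proof -
  have "{c \<in> (`) \<theta> ` X. f ` c \<noteq> {\<zero>\<^bsub>W\<^esub>}} = (`) \<theta> ` {c \<in> X. (f \<circ> \<theta>) ` c \<noteq> {\<zero>\<^bsub>W\<^esub>}}"
    by (auto simp: image_comp)
  moreover have "inj_on ((`) \<theta>) {c \<in> X. (f \<circ> \<theta>) ` c \<noteq> {\<zero>\<^bsub>W\<^esub>}}"
    using assms by (rule inj_on_subset) auto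
  ultimately show ?thesis
    by (simp add: coset_summable_def finite_image_iff image_comp)
qed

locale additive_module = abelian_monoid W
  for W :: "('c, 'w, 'a) module_scheme" (structure)
begin

lemma coset_sum_closed:
  assumes "coset_summable W f X"
  shows "coset_sum W f X \<in> carrier W"
  unfolding coset_sum_def
  using add.gfinprod_closed[of "\<lambda>c. the_elem (f ` c)" X] coset_summable_the_elem(1)[OF assms] by auto

lemma coset_sum_cong:
  assumes "coset_summable W f X" "\<And>c x. c \<in> X \<Longrightarrow> x \<in> c \<Longrightarrow> f x = g x"
  shows "coset_sum W f X = coset_sum W g X"
proof -
  have eq: "f ` c = g ` c" if "c \<in> X" for c
    using assms that by (intro image_cong) auto
  have "gfinprod (add_monoid W) (\<lambda>c. the_elem (g ` c)) X
      = gfinprod (add_monoid W) (\<lambda>c. the_elem (f ` c)) X"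
    using eq coset_summable_the_elem(1)[OF assms(1)]
    by (intro add.gfinprod_cong) (auto simp: simp_implies_def)
  then show ?thesis by (simp add: coset_sum_def)
qed

lemma coset_sum_zero:
  assumes "\<And>c. c \<in> X \<Longrightarrow> f ` c = {\<zero>}"
  shows "coset_sum W f X = \<zero>"
proof -
  have "{c \<in> X. the_elem (f ` c) \<noteq> \<zero>} = {}" using assms by auto
  then show ?thesis
    by (simp only: coset_sum_def gfinprod_def monoid.select_convs if_True finite.emptyI
        finsum_def[symmetric] finsum_empty)
qed

text \<open>By definition \<open>gfinprod\<close> is a finite sum over the support. The action of
  \<open>\<theta>\<close> carries one support bijectively onto the other, so the reindexing takes
  place between finite sums.\<close>

lemma coset_sum_reindex:
  assumes "inj_on ((`) \<theta>) X" "coset_summable W (f \<circ> \<theta>) X"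
  shows "coset_sum W f ((`) \<theta> ` X) = coset_sum W (f \<circ> \<theta>) X"
proof -
  let ?Y = "{c \<in> X. the_elem ((f \<circ> \<theta>) ` c) \<noteq> \<zero>}"
  have eq: "{c \<in> (`) \<theta> ` X. the_elem (f ` c) \<noteq> \<zero>} = (`) \<theta> ` ?Y"
    by (auto simp: image_comp)
  have inj: "inj_on ((`) \<theta>) ?Y" using assms(1) by (rule inj_on_subset) auto
  have "finsum W (\<lambda>c. the_elem (f ` c)) ((`) \<theta> ` ?Y)
      = finsum W (\<lambda>c. the_elem (f ` (\<theta> ` c))) ?Y"
    by (rule add.finprod_reindex[OF _ inj])
       (use coset_summable_the_elem(1)[OF assms(2)] in \<open>auto simp: image_comp comp_def\<close>)
  then show ?thesis
    using coset_summable_finite[OF assms(2)] inj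
    by (simp add: coset_sum_def gfinprod_def eq finite_image_iff image_comp flip: finsum_def)
qed

text \<open>The support of the sum lies in the union of the two supports; cancellation may make it
  smaller.\<close>

lemma coset_summable_add:
  assumes f: "coset_summable W f X" and g: "coset_summable W g X"
  shows "coset_summable W (\<lambda>x. f x \<oplus> g x) X"
    and "c \<in> X \<Longrightarrow> the_elem ((\<lambda>x. f x \<oplus> g x) ` c) = the_elem (f ` c) \<oplus> the_elem (g ` c)"
proof -
  have im: "(\<lambda>x. f x \<oplus> g x) ` c = {the_elem (f ` c) \<oplus> the_elem (g ` c)}" if "c \<in> X" for c
  proof -
    have "f ` c = {the_elem (f ` c)}" "g ` c = {the_elem (g ` c)}"
      using coset_summable_the_elem(2) f g that by blast+
    then have "\<And>x. x \<in> c \<Longrightarrow> f x = the_elem (f ` c)" "\<And>x. x \<in> c \<Longrightarrow> g x = the_elem (g ` c)" "c \<noteq> {}"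
      by blast+
    then show ?thesis by auto
  qed
  show "the_elem ((\<lambda>x. f x \<oplus> g x) ` c) = the_elem (f ` c) \<oplus> the_elem (g ` c)" if "c \<in> X"
    using im[OF that] by simp
  have "{c \<in> X. (\<lambda>x. f x \<oplus> g x) ` c \<noteq> {\<zero>}}
      \<subseteq> {c \<in> X. the_elem (f ` c) \<noteq> \<zero>} \<union> {c \<in> X. the_elem (g ` c) \<noteq> \<zero>}"
  proof (rule subsetI, rule ccontr)
    fix c assume c: "c \<in> {c \<in> X. (\<lambda>x. f x \<oplus> g x) ` c \<noteq> {\<zero>}}"
      "c \<notin> {c \<in> X. the_elem (f ` c) \<noteq> \<zero>} \<union> {c \<in> X. the_elem (g ` c) \<noteq> \<zero>}"
    then have "c \<in> X" "the_elem (f ` c) = \<zero>" "the_elem (g ` c) = \<zero>" by blast+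
    then show False using im[of c] c(1) by simp
  qed
  then have "finite {c \<in> X. (\<lambda>x. f x \<oplus> g x) ` c \<noteq> {\<zero>}}"
    using coset_summable_finite[OF f] coset_summable_finite[OF g] finite_subset by blast
  then show "coset_summable W (\<lambda>x. f x \<oplus> g x) X"
    using im coset_summable_the_elem(1)[OF f] coset_summable_the_elem(1)[OF g]
    by (auto simp: coset_summable_def)
qed

lemma coset_sum_add:
  assumes "coset_summable W f X" "coset_summable W g X"
  shows "coset_sum W (\<lambda>x. f x \<oplus> g x) X = coset_sum W f X \<oplus> coset_sum W g X"
proof -
  have "gfinprod (add_monoid W) (\<lambda>c. the_elem ((\<lambda>x. f x \<oplus> g x) ` c)) X
      = gfinprod (add_monoid W) (\<lambda>c. the_elem (f ` c) \<oplus> the_elem (g ` c)) X"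
    using coset_summable_the_elem(1)[OF assms(1)] coset_summable_the_elem(1)[OF assms(2)]
    by (intro add.gfinprod_cong) (auto simp: coset_summable_add(2)[OF assms] simp_implies_def)
  also have "\<dots> = gfinprod (add_monoid W) (\<lambda>c. the_elem (f ` c)) X
      \<oplus> gfinprod (add_monoid W) (\<lambda>c. the_elem (g ` c)) X"
    using add.gfinprod_distrib[of X "\<lambda>c. the_elem (f ` c)" "\<lambda>c. the_elem (g ` c)"]
      coset_summable_the_elem(1)[OF assms(1)] coset_summable_the_elem(1)[OF assms(2)]
      coset_summable_finite[OF assms(1)] coset_summable_finite[OF assms(2)]
    by simp
  finally show ?thesis by (simp add: coset_sum_def)
qed

text \<open>An infinite index set is harmless: both sums are then zero by convention, and
  \<open>h\<close> preserves zero.\<close>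

lemma finsum_additive_image:
  assumes W: "abelian_monoid W'"
    and h: "h \<in> carrier W \<rightarrow> carrier W'" "h \<zero> = \<zero>\<^bsub>W'\<^esub>"
      "\<And>x y. x \<in> carrier W \<Longrightarrow> y \<in> carrier W \<Longrightarrow> h (x \<oplus> y) = h x \<oplus>\<^bsub>W'\<^esub> h y"
    and F: "F \<in> A \<rightarrow> carrier W"
  shows "h (finsum W F A) = finsum W' (\<lambda>x. h (F x)) A"
proof -
  interpret W: abelian_monoid W' by fact
  show ?thesis using F
  proof (induct A rule: infinite_finite_induct)
    case (insert a A)
    then have F: "F a \<in> carrier W" "F \<in> A \<rightarrow> carrier W" by auto
    then have "h (F a) \<in> carrier W'" "(\<lambda>x. h (F x)) \<in> A \<rightarrow> carrier W'" using h(1) by auto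
    then show ?case using F insert(1,2) insert(3)[OF F(2)]
      by (simp add: finsum_insert W.finsum_insert h(3))
  qed (simp_all add: h(2) finsum_infinite W.finsum_infinite)
qed

text \<open>Serves for four additive maps: evaluation at a vector, evaluation of \<open>e\<close> at
  an invariant functional, the action of an element of \<open>K\<close>, and multiplication by a
  scalar. Since \<open>h\<close> may kill nonzero terms, both sums are compared on the support
  \<open>?Y\<close> of \<open>f\<close> rather than on their own supports.\<close>

lemma coset_sum_hom:
  assumes W: "abelian_monoid W'"
    and h: "h \<in> carrier W \<rightarrow> carrier W'" "h \<zero> = \<zero>\<^bsub>W'\<^esub>"
      "\<And>x y. x \<in> carrier W \<Longrightarrow> y \<in> carrier W \<Longrightarrow> h (x \<oplus> y) = h x \<oplus>\<^bsub>W'\<^esub> h y"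
    and f: "coset_summable W f X"
  shows "coset_summable W' (h \<circ> f) X"
    and "h (coset_sum W f X) = coset_sum W' (h \<circ> f) X"
proof -
  interpret W: abelian_monoid W' by fact
  have im: "(h \<circ> f) ` c = {h (the_elem (f ` c))}" if "c \<in> X" for c
    using coset_summable_the_elem(2)[OF f that] by (metis image_comp image_insert image_empty)
  let ?Y = "{c \<in> X. the_elem (f ` c) \<noteq> \<zero>}"
  have fin: "finite ?Y" by (rule coset_summable_finite[OF f])
  have sub: "{c \<in> X. (h \<circ> f) ` c \<noteq> {\<zero>\<^bsub>W'\<^esub>}} \<subseteq> ?Y"
    by (rule subsetI) (use im h(2) in force)
  then have fin': "finite {c \<in> X. (h \<circ> f) ` c \<noteq> {\<zero>\<^bsub>W'\<^esub>}}" using fin finite_subset by blast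
  then show summ: "coset_summable W' (h \<circ> f) X"
    using im funcset_mem[OF h(1) coset_summable_the_elem(1)[OF f]]
    unfolding coset_summable_def by blast
  have zero: "the_elem ((h \<circ> f) ` c) = \<zero>\<^bsub>W'\<^esub>" if "c \<in> X" "the_elem (f ` c) = \<zero>" for c
    using im[OF that(1)] that(2) h(2) by simp
  have "coset_sum W' (h \<circ> f) X = gfinprod (add_monoid W') (\<lambda>c. the_elem ((h \<circ> f) ` c)) ?Y"
    unfolding coset_sum_def
    using zero coset_summable_the_elem(1)[OF summ]
    by (intro W.add.gfinprod_mono_neutral_cong_right) (auto simp del: o_apply)
  also have "\<dots> = finsum W' (\<lambda>c. h (the_elem (f ` c))) ?Y"
  proof -
    have "gfinprod (add_monoid W') (\<lambda>c. the_elem ((h \<circ> f) ` c)) ?Y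
        = finsum W' (\<lambda>c. the_elem ((h \<circ> f) ` c)) ?Y"
      using fin coset_summable_the_elem(1)[OF summ] by (intro W.add.gfinprod_eq_finprod) auto
    also have "\<dots> = finsum W' (\<lambda>c. h (the_elem (f ` c))) ?Y"
    proof (rule W.finsum_cong'[OF refl])
      show "(\<lambda>c. h (the_elem (f ` c))) \<in> ?Y \<rightarrow> carrier W'"
        using funcset_mem[OF h(1) coset_summable_the_elem(1)[OF f]] by blast
      show "the_elem ((h \<circ> f) ` c) = h (the_elem (f ` c))" if "c \<in> ?Y" for c
        using im[of c] that by simp
    qed
    finally show ?thesis .
  qed
  also have "\<dots> = h (finsum W (\<lambda>c. the_elem (f ` c)) ?Y)"
    using finsum_additive_image[OF W h, of "\<lambda>c. the_elem (f ` c)" ?Y]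
      coset_summable_the_elem(1)[OF f] by auto
  also have "finsum W (\<lambda>c. the_elem (f ` c)) ?Y = coset_sum W f X"
    using fin by (simp add: coset_sum_def gfinprod_def flip: finsum_def)
  finally show "h (coset_sum W f X) = coset_sum W' (h \<circ> f) X" by (rule sym)
qed

end

section \<open>Duals and quotients of vector spaces\<close>

lemma lin_mapsI:
  assumes "f \<in> extensional (carrier V)" "\<And>v. v \<in> carrier V \<Longrightarrow> f v \<in> carrier W"
    "\<And>u v. u \<in> carrier V \<Longrightarrow> v \<in> carrier V \<Longrightarrow> f (u \<oplus>\<^bsub>V\<^esub> v) = f u \<oplus>\<^bsub>W\<^esub> f v"
    "\<And>a v. a \<in> carrier C \<Longrightarrow> v \<in> carrier V \<Longrightarrow> f (a \<odot>\<^bsub>V\<^esub> v) = a \<odot>\<^bsub>W\<^esub> f v"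
  shows "f \<in> lin_maps C V W"
  using assms by (auto simp: lin_maps_def module_hom_def)

lemma lin_mapsD:
  assumes "f \<in> lin_maps C V W"
  shows "f \<in> extensional (carrier V)" "v \<in> carrier V \<Longrightarrow> f v \<in> carrier W"
    "u \<in> carrier V \<Longrightarrow> v \<in> carrier V \<Longrightarrow> f (u \<oplus>\<^bsub>V\<^esub> v) = f u \<oplus>\<^bsub>W\<^esub> f v"
    "a \<in> carrier C \<Longrightarrow> v \<in> carrier V \<Longrightarrow> f (a \<odot>\<^bsub>V\<^esub> v) = a \<odot>\<^bsub>W\<^esub> f v"
  using assms by (auto simp: lin_maps_def module_hom_def)

lemma dual_carrier: "carrier (dual C V) = lin_maps C V (scalar_module C)"
  by (simp add: dual_def)

context vectorspace
begin

lemma scalar_module_simps [simp]: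
  "carrier (scalar_module K) = carrier K" "\<zero>\<^bsub>scalar_module K\<^esub> = \<zero>\<^bsub>K\<^esub>"
  "a \<oplus>\<^bsub>scalar_module K\<^esub> b = a \<oplus>\<^bsub>K\<^esub> b" "a \<odot>\<^bsub>scalar_module K\<^esub> b = a \<otimes>\<^bsub>K\<^esub> b"
  by (simp_all add: scalar_module_def)

lemma scalar_module_abelian_monoid: "abelian_monoid (scalar_module K)"
  by (rule abelian_monoidI) (simp_all add: R.a_ac)

lemma dual_simps:
  "carrier (dual K V) = lin_maps K V (scalar_module K)"
  "\<zero>\<^bsub>dual K V\<^esub> = (\<lambda>v\<in>carrier V. \<zero>\<^bsub>K\<^esub>)"
  "l \<oplus>\<^bsub>dual K V\<^esub> l' = (\<lambda>v\<in>carrier V. l v \<oplus>\<^bsub>K\<^esub> l' v)"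
  "a \<odot>\<^bsub>dual K V\<^esub> l = (\<lambda>v\<in>carrier V. a \<otimes>\<^bsub>K\<^esub> l v)"
  by (simp_all add: dual_def func_space_def)

lemma dual_apply:
  assumes "v \<in> carrier V"
  shows "\<zero>\<^bsub>dual K V\<^esub> v = \<zero>\<^bsub>K\<^esub>"
    "(l \<oplus>\<^bsub>dual K V\<^esub> l') v = l v \<oplus>\<^bsub>K\<^esub> l' v"
    "(a \<odot>\<^bsub>dual K V\<^esub> l) v = a \<otimes>\<^bsub>K\<^esub> l v"
  using assms by (simp_all add: dual_simps)

lemma dualI:
  assumes "l \<in> extensional (carrier V)" "\<And>v. v \<in> carrier V \<Longrightarrow> l v \<in> carrier K"
    "\<And>u v. u \<in> carrier V \<Longrightarrow> v \<in> carrier V \<Longrightarrow> l (u \<oplus>\<^bsub>V\<^esub> v) = l u \<oplus>\<^bsub>K\<^esub> l v"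
    "\<And>a v. a \<in> carrier K \<Longrightarrow> v \<in> carrier V \<Longrightarrow> l (a \<odot>\<^bsub>V\<^esub> v) = a \<otimes>\<^bsub>K\<^esub> l v"
  shows "l \<in> carrier (dual K V)"
  unfolding dual_simps by (rule lin_mapsI) (use assms in auto)

lemma dualD:
  assumes "l \<in> carrier (dual K V)"
  shows "l \<in> extensional (carrier V)" "v \<in> carrier V \<Longrightarrow> l v \<in> carrier K"
    "u \<in> carrier V \<Longrightarrow> v \<in> carrier V \<Longrightarrow> l (u \<oplus>\<^bsub>V\<^esub> v) = l u \<oplus>\<^bsub>K\<^esub> l v"
    "a \<in> carrier K \<Longrightarrow> v \<in> carrier V \<Longrightarrow> l (a \<odot>\<^bsub>V\<^esub> v) = a \<otimes>\<^bsub>K\<^esub> l v"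
  using assms lin_mapsD[of l K V "scalar_module K"] by (simp_all add: dual_simps)

lemma dual_ext:
  assumes "l \<in> carrier (dual K V)" "l' \<in> carrier (dual K V)" "\<And>v. v \<in> carrier V \<Longrightarrow> l v = l' v"
  shows "l = l'"
  using extensionalityI[OF dualD(1)[OF assms(1)] dualD(1)[OF assms(2)]] assms(3) by blast

lemma dual_vanish_zero:
  assumes "l \<in> carrier (dual K V)"
  shows "l \<zero>\<^bsub>V\<^esub> = \<zero>\<^bsub>K\<^esub>"
  using dualD(4)[OF assms, of "\<zero>\<^bsub>K\<^esub>" "\<zero>\<^bsub>V\<^esub>"] dualD(2)[OF assms] by simp

lemma dual_minus:
  assumes "l \<in> carrier (dual K V)" "u \<in> carrier V" "v \<in> carrier V"
  shows "l (u \<ominus>\<^bsub>V\<^esub> v) = l u \<ominus>\<^bsub>K\<^esub> l v"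
proof -
  have "l (u \<ominus>\<^bsub>V\<^esub> v) \<oplus>\<^bsub>K\<^esub> l v = l u"
    using dualD(3)[OF assms(1), of "u \<ominus>\<^bsub>V\<^esub> v" v] assms
    by (simp add: M.minus_eq M.a_assoc M.l_neg)
  moreover have "l (u \<ominus>\<^bsub>V\<^esub> v) \<in> carrier K" "l u \<in> carrier K" "l v \<in> carrier K"
    using dualD(2)[OF assms(1)] assms by auto
  ultimately show ?thesis by (metis R.add.inv_solve_right' R.minus_eq)
qed

text \<open>\<open>dual\<close> keeps the operations of the space of all functions and only shrinks
  the carrier, so it is enough that the linear functionals form a submodule.\<close>

lemma dual_vectorspace: "vectorspace K (dual K V)"
proof -
  have "module K (func_space (carrier V))" by (rule func_space_is_module)
  moreover have "submodule K (lin_maps K V (scalar_module K)) (func_space (carrier V))"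
  proof (rule submodule.intro[OF func_space_is_module])
    show "lin_maps K V (scalar_module K) \<subseteq> carrier (func_space (carrier V))"
      proof
      fix l assume "l \<in> lin_maps K V (scalar_module K)"
      then have "l \<in> carrier (dual K V)" by (simp add: dual_simps)
      from dualD(1,2)[OF this] show "l \<in> carrier (func_space (carrier V))"
        by (simp add: func_space_def PiE_def)
    qed
    fix l l' assume "l \<in> lin_maps K V (scalar_module K)" "l' \<in> lin_maps K V (scalar_module K)"
    then have l: "l \<in> carrier (dual K V)" "l' \<in> carrier (dual K V)" by (auto simp: dual_simps)
    show "l \<oplus>\<^bsub>func_space (carrier V)\<^esub> l' \<in> lin_maps K V (scalar_module K)"
      unfolding dual_simps(1)[symmetric]
      by (rule dualI) (auto simp: func_space_def dualD[OF l(1)] dualD[OF l(2)] R.a_ac R.r_distr)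
  next
    show "\<zero>\<^bsub>func_space (carrier V)\<^esub> \<in> lin_maps K V (scalar_module K)"
      unfolding dual_simps(1)[symmetric] by (rule dualI) (auto simp: func_space_def)
  next
    fix a l assume "a \<in> carrier K" "l \<in> lin_maps K V (scalar_module K)"
    then have l: "a \<in> carrier K" "l \<in> carrier (dual K V)" by (auto simp: dual_simps)
    show "a \<odot>\<^bsub>func_space (carrier V)\<^esub> l \<in> lin_maps K V (scalar_module K)"
      unfolding dual_simps(1)[symmetric]
      by (rule dualI) (use l(1) in \<open>auto simp: func_space_def dualD[OF l(2)] R.m_ac R.r_distr\<close>)
  qed
  ultimately have "module K (dual K V)"
    unfolding dual_def by (rule LinearCombinations.module.submodule_is_module)
  then show ?thesis by (simp add: vectorspace_def field.field_axioms)
qed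

section \<open>Separating functionals and the bidual\<close>

lemma submodule_minus_closed:
  assumes "submodule K U V" "x \<in> U" "y \<in> U"
  shows "x \<ominus>\<^bsub>V\<^esub> y \<in> U"
proof -
  have "y \<in> carrier V" using assms submodule.subset by blast
  then have "\<ominus>\<^bsub>V\<^esub> y = (\<ominus>\<^bsub>K\<^esub> \<one>\<^bsub>K\<^esub>) \<odot>\<^bsub>V\<^esub> y"
    by (simp add: smult_l_minus)
  then show ?thesis
    using assms by (simp add: M.minus_eq submodule.m_closed submodule.smult_closed)
qed

text \<open>A maximal subspace containing \<open>U\<close> but not \<open>v\<close> is complementary to the line through \<open>v\<close>,
  so the coordinate along \<open>v\<close> is a functional as required.\<close>

lemma separating_functional:
  assumes U: "submodule K U V" and v: "v \<in> carrier V" "v \<notin> U"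
  obtains l where "l \<in> carrier (dual K V)" "\<And>u. u \<in> U \<Longrightarrow> l u = \<zero>\<^bsub>K\<^esub>" "l v = \<one>\<^bsub>K\<^esub>"
proof -
  define \<S> where "\<S> = {S. submodule K S V \<and> U \<subseteq> S \<and> v \<notin> S}"
  have "\<exists>S\<in>\<S>. \<forall>X\<in>\<S>. S \<subseteq> X \<longrightarrow> X = S"
  proof (rule subset_Zorn_nonempty)
    show "\<S> \<noteq> {}" using U v by (auto simp: \<S>_def)
    fix \<C> assume \<C>: "\<C> \<noteq> {}" "subset.chain \<S> \<C>"
    then have sub: "\<C> \<subseteq> \<S>" by (simp add: subset.chain_def)
    have "submodule K (\<Union>\<C>) V"
    proof (rule nested_union_vs[where I = \<C> and N = "\<lambda>S. S"])
      fix i j assume "i \<in> \<C>" "j \<in> \<C>"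
      then have "i \<subseteq> j \<or> j \<subseteq> i" using \<C>(2) by (auto simp: subset.chain_def)
      then show "\<exists>k. k \<in> \<C> \<and> i \<subseteq> k \<and> j \<subseteq> k" using \<open>i \<in> \<C>\<close> \<open>j \<in> \<C>\<close> by blast
    qed (use sub \<C>(1) in \<open>auto simp: \<S>_def\<close>)
    then show "\<Union>\<C> \<in> \<S>" using sub \<C>(1) by (fastforce simp: \<S>_def)
  qed
  then obtain S where S: "submodule K S V" "U \<subseteq> S" "v \<notin> S"
    and max: "\<And>X. submodule K X V \<Longrightarrow> S \<subseteq> X \<Longrightarrow> v \<notin> X \<Longrightarrow> X = S"
    unfolding \<S>_def by auto
  note Scl = submodule.m_closed[OF S(1)] submodule.smult_closed[OF S(1)] submodule.zero_closed[OF S(1)]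
  have Sc: "x \<in> S \<Longrightarrow> x \<in> carrier V" for x using submodule.subset[OF S(1)] by blast
  have minus_zero: "\<ominus>\<^bsub>V\<^esub> \<zero>\<^bsub>V\<^esub> = \<zero>\<^bsub>V\<^esub>"
    by (metis M.r_neg M.l_zero M.zero_closed M.a_inv_closed)
  \<comment> \<open>\<open>R x c\<close> says that \<open>c\<close> is the coordinate of
    \<open>x\<close> along \<open>v\<close> modulo \<open>S\<close>. Maximality of \<open>S\<close>
    gives existence, and \<open>v\<close> being outside \<open>S\<close> gives uniqueness.\<close>
  define R where "R x c \<longleftrightarrow> c \<in> carrier K \<and> x \<ominus>\<^bsub>V\<^esub> c \<odot>\<^bsub>V\<^esub> v \<in> S" for x c
  have ex: "\<exists>c. R x c" if x: "x \<in> carrier V" for x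
  proof (cases "x \<in> S")
    case True
    then show ?thesis using v x by (intro exI[of _ "\<zero>\<^bsub>K\<^esub>"]) (simp add: R_def M.minus_eq minus_zero)
  next
    case False
    \<comment> \<open>\<open>S'\<close> is \<open>S\<close> plus the line through \<open>x\<close>.
      It properly contains \<open>S\<close>, hence contains \<open>v\<close>. In
      \<open>v = s + c x\<close> the scalar \<open>c\<close> is nonzero because \<open>v\<close> is
      not in \<open>S\<close>, so the equation can be solved for \<open>x\<close> modulo
      \<open>S\<close>.\<close>
    define S' where "S' = {s \<oplus>\<^bsub>V\<^esub> c \<odot>\<^bsub>V\<^esub> x | s c. s \<in> S \<and> c \<in> carrier K}"
    have "submodule K S' V"
    proof (rule submodule.intro)
      show "module K V" by (rule module_axioms)
      show "S' \<subseteq> carrier V" using x Sc by (auto simp: S'_def)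
      show "\<zero>\<^bsub>V\<^esub> \<in> S'" unfolding S'_def
        using Scl(3) x by (intro CollectI exI[of _ "\<zero>\<^bsub>V\<^esub>"] exI[of _ "\<zero>\<^bsub>K\<^esub>"]) simp
    next
      fix y z assume "y \<in> S'" "z \<in> S'"
      then obtain s c t d where "s \<in> S" "c \<in> carrier K" "t \<in> S" "d \<in> carrier K"
        "y = s \<oplus>\<^bsub>V\<^esub> c \<odot>\<^bsub>V\<^esub> x" "z = t \<oplus>\<^bsub>V\<^esub> d \<odot>\<^bsub>V\<^esub> x" by (auto simp: S'_def)
      then show "y \<oplus>\<^bsub>V\<^esub> z \<in> S'" unfolding S'_def using x Sc Scl(1)
        by (intro CollectI exI[of _ "s \<oplus>\<^bsub>V\<^esub> t"] exI[of _ "c \<oplus>\<^bsub>K\<^esub> d"])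
           (simp add: smult_l_distr M.a_ac)
    next
      fix a y assume "a \<in> carrier K" "y \<in> S'"
      moreover then obtain s c where "s \<in> S" "c \<in> carrier K" "y = s \<oplus>\<^bsub>V\<^esub> c \<odot>\<^bsub>V\<^esub> x"
        by (auto simp: S'_def)
      ultimately show "a \<odot>\<^bsub>V\<^esub> y \<in> S'" unfolding S'_def using x Sc Scl(2)
        by (intro CollectI exI[of _ "a \<odot>\<^bsub>V\<^esub> s"] exI[of _ "a \<otimes>\<^bsub>K\<^esub> c"])
           (simp add: smult_r_distr smult_assoc1)
    qed
    moreover have "S \<subseteq> S'"
    proof
      fix s assume "s \<in> S"
      then show "s \<in> S'" unfolding S'_def
        using x Sc by (intro CollectI exI[of _ s] exI[of _ "\<zero>\<^bsub>K\<^esub>"]) simp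
    qed
    moreover have "x \<in> S'" unfolding S'_def
      using x Scl(3) by (intro CollectI exI[of _ "\<zero>\<^bsub>V\<^esub>"] exI[of _ "\<one>\<^bsub>K\<^esub>"]) simp
    ultimately have "v \<in> S'" using max[of S'] False by blast
    then obtain s c where sc: "s \<in> S" "c \<in> carrier K" "v = s \<oplus>\<^bsub>V\<^esub> c \<odot>\<^bsub>V\<^esub> x"
      by (auto simp: S'_def)
    have "c \<noteq> \<zero>\<^bsub>K\<^esub>" using sc S(3) x Sc by auto
    then have "c \<in> Units K" using sc(2) by (simp add: field_Units)
    then obtain d where d: "d \<in> carrier K" "d \<otimes>\<^bsub>K\<^esub> c = \<one>\<^bsub>K\<^esub>"
      using R.Units_inv_closed R.Units_l_inv by blast
    have dv: "d \<odot>\<^bsub>V\<^esub> v = d \<odot>\<^bsub>V\<^esub> s \<oplus>\<^bsub>V\<^esub> x"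
      using sc d x Sc by (simp add: smult_r_distr smult_assoc1[symmetric])
    have "d \<odot>\<^bsub>V\<^esub> s \<in> carrier V" using d sc Sc by simp
    then have "x \<ominus>\<^bsub>V\<^esub> d \<odot>\<^bsub>V\<^esub> v = \<zero>\<^bsub>V\<^esub> \<ominus>\<^bsub>V\<^esub> d \<odot>\<^bsub>V\<^esub> s"
      unfolding dv using x by (simp add: M.minus_eq M.minus_add M.a_ac M.r_neg M.r_neg1 M.r_neg2)
    then have "R x d" unfolding R_def
      using submodule_minus_closed[OF S(1) Scl(3) Scl(2)[OF d(1) sc(1)]] d by simp
    then show ?thesis ..
  qed
  have uniq: "c = d" if "R x c" "R x d" "x \<in> carrier V" for x c d
  proof (rule ccontr)
    assume "c \<noteq> d"
    have cd: "c \<in> carrier K" "d \<in> carrier K" using that by (auto simp: R_def)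
    then have "c \<ominus>\<^bsub>K\<^esub> d \<in> Units K" using \<open>c \<noteq> d\<close> by (simp add: field_Units)
    then obtain b where b: "b \<in> carrier K" "b \<otimes>\<^bsub>K\<^esub> (c \<ominus>\<^bsub>K\<^esub> d) = \<one>\<^bsub>K\<^esub>"
      using R.Units_inv_closed R.Units_l_inv by blast
    have "(x \<ominus>\<^bsub>V\<^esub> d \<odot>\<^bsub>V\<^esub> v) \<ominus>\<^bsub>V\<^esub> (x \<ominus>\<^bsub>V\<^esub> c \<odot>\<^bsub>V\<^esub> v) \<in> S"
      using that submodule_minus_closed[OF S(1)] by (auto simp: R_def)
    also have "(x \<ominus>\<^bsub>V\<^esub> d \<odot>\<^bsub>V\<^esub> v) \<ominus>\<^bsub>V\<^esub> (x \<ominus>\<^bsub>V\<^esub> c \<odot>\<^bsub>V\<^esub> v)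
        = (c \<ominus>\<^bsub>K\<^esub> d) \<odot>\<^bsub>V\<^esub> v"
      using that(3) v cd
      by (simp add: M.minus_eq R.minus_eq M.minus_add smult_l_distr smult_l_minus M.a_ac M.r_neg M.r_neg1 M.r_neg2)
    finally have "b \<odot>\<^bsub>V\<^esub> ((c \<ominus>\<^bsub>K\<^esub> d) \<odot>\<^bsub>V\<^esub> v) \<in> S" using Scl(2) b by blast
    then show False using S(3) v b cd by (simp add: smult_assoc1[symmetric])
  qed
  define l where "l = (\<lambda>x\<in>carrier V. THE c. R x c)"
  have lR: "l x = c" if "x \<in> carrier V" "R x c" for x c
    using that uniq by (auto simp: l_def intro!: the_equality)
  have Rl: "R x (l x)" if "x \<in> carrier V" for x using ex[OF that] lR that by metis
  have lc: "l x \<in> carrier K" if "x \<in> carrier V" for x using Rl[OF that] by (simp add: R_def)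
  show thesis
  proof (rule that)
    show "l \<in> carrier (dual K V)"
    proof (rule dualI)
      show "l \<in> extensional (carrier V)" by (simp add: l_def)
      show "l x \<in> carrier K" if "x \<in> carrier V" for x by (rule lc[OF that])
    next
      fix x y assume xy: "x \<in> carrier V" "y \<in> carrier V"
      have "(x \<ominus>\<^bsub>V\<^esub> l x \<odot>\<^bsub>V\<^esub> v) \<oplus>\<^bsub>V\<^esub> (y \<ominus>\<^bsub>V\<^esub> l y \<odot>\<^bsub>V\<^esub> v) \<in> S"
        using Rl[OF xy(1)] Rl[OF xy(2)] Scl(1) by (simp add: R_def)
      also have "(x \<ominus>\<^bsub>V\<^esub> l x \<odot>\<^bsub>V\<^esub> v) \<oplus>\<^bsub>V\<^esub> (y \<ominus>\<^bsub>V\<^esub> l y \<odot>\<^bsub>V\<^esub> v)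
          = (x \<oplus>\<^bsub>V\<^esub> y) \<ominus>\<^bsub>V\<^esub> (l x \<oplus>\<^bsub>K\<^esub> l y) \<odot>\<^bsub>V\<^esub> v"
        using xy lc v by (simp add: M.minus_eq smult_l_distr M.minus_add M.a_ac)
      finally show "l (x \<oplus>\<^bsub>V\<^esub> y) = l x \<oplus>\<^bsub>K\<^esub> l y"
        using xy lc by (intro lR) (auto simp: R_def)
    next
      fix a x assume ax: "a \<in> carrier K" "x \<in> carrier V"
      have "a \<odot>\<^bsub>V\<^esub> (x \<ominus>\<^bsub>V\<^esub> l x \<odot>\<^bsub>V\<^esub> v) \<in> S"
        using Rl[OF ax(2)] Scl(2) ax by (simp add: R_def)
      also have "a \<odot>\<^bsub>V\<^esub> (x \<ominus>\<^bsub>V\<^esub> l x \<odot>\<^bsub>V\<^esub> v)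
          = a \<odot>\<^bsub>V\<^esub> x \<ominus>\<^bsub>V\<^esub> (a \<otimes>\<^bsub>K\<^esub> l x) \<odot>\<^bsub>V\<^esub> v"
        using ax lc v by (simp add: M.minus_eq smult_r_distr smult_r_minus smult_assoc1)
      finally show "l (a \<odot>\<^bsub>V\<^esub> x) = a \<otimes>\<^bsub>K\<^esub> l x"
        using ax lc by (intro lR) (auto simp: R_def)
    qed
    show "l u = \<zero>\<^bsub>K\<^esub>" if "u \<in> U" for u
      using that S(2) Sc v by (intro lR) (auto simp: R_def M.minus_eq minus_zero)
    show "l v = \<one>\<^bsub>K\<^esub>"
      using v Scl(3) by (intro lR) (auto simp: R_def M.minus_eq M.r_neg)
  qed
qed

lemma bidual_map_apply: "l \<in> carrier (dual K V) \<Longrightarrow> bidual_map K V v l = l v"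
  by (simp add: bidual_map_def)

lemma bidual_map_closed:
  assumes "v \<in> carrier V"
  shows "bidual_map K V v \<in> carrier (dual K (dual K V))"
proof -
  interpret D: vectorspace K "dual K V" by (rule dual_vectorspace)
  show ?thesis
    by (rule D.dualI) (use assms in \<open>auto simp: bidual_map_def dual_apply dualD(2)\<close>)
qed

lemma zero_submodule: "submodule K {\<zero>\<^bsub>V\<^esub>} V"
  by (rule submodule.intro) (auto intro: module_axioms)

text \<open>Separates \<open>u - v\<close> from the zero subspace. Identities between values of
  \<open>iota\<close> are proved by this route, because those values are described by their pairings
  with functionals.\<close>

lemma functionals_separate:
  assumes "u \<in> carrier V" "v \<in> carrier V" "\<And>l. l \<in> carrier (dual K V) \<Longrightarrow> l u = l v"
  shows "u = v"
proof (rule ccontr)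
  assume "u \<noteq> v"
  then have "u \<ominus>\<^bsub>V\<^esub> v \<notin> {\<zero>\<^bsub>V\<^esub>}" using assms(1,2) by simp
  then obtain l where "l \<in> carrier (dual K V)" "l (u \<ominus>\<^bsub>V\<^esub> v) = \<one>\<^bsub>K\<^esub>"
    using separating_functional[OF zero_submodule, of "u \<ominus>\<^bsub>V\<^esub> v"] assms(1,2) by blast
  moreover then have "l (u \<ominus>\<^bsub>V\<^esub> v) = \<zero>\<^bsub>K\<^esub>"
    using assms(1,2) dualD(2)[of l v] by (simp add: dual_minus assms(3) R.minus_eq R.r_neg)
  ultimately show False by simp
qed

lemma bidual_map_inj: "inj_on (bidual_map K V) (carrier V)"
proof (rule inj_onI)
  fix u v assume "u \<in> carrier V" "v \<in> carrier V" and eq: "bidual_map K V u = bidual_map K V v"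
  then show "u = v" using functionals_separate[of u v] bidual_map_apply by metis
qed

text \<open>The kernel of \<open>l\<close> is a subspace, so it contains the span of any of its
  subsets.\<close>

lemma dual_vanish_span:
  assumes l: "l \<in> carrier (dual K V)" and S: "S \<subseteq> carrier V" "\<And>s. s \<in> S \<Longrightarrow> l s = \<zero>\<^bsub>K\<^esub>"
    and v: "v \<in> span S"
  shows "l v = \<zero>\<^bsub>K\<^esub>"
proof -
  have "submodule K {u \<in> carrier V. l u = \<zero>\<^bsub>K\<^esub>} V"
    by (rule submodule.intro)
      (auto intro: module_axioms simp: dualD(3,4)[OF l] dual_vanish_zero[OF l])
  then have "span S \<subseteq> {u \<in> carrier V. l u = \<zero>\<^bsub>K\<^esub>}"
    using S by (intro span_is_subset) auto
  then show ?thesis using v by blast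
qed

text \<open>Induction on \<open>S\<close>: a functional \<open>l\<^sub>0\<close> vanishing on \<open>S\<close> with \<open>l\<^sub>0(s) = 1\<close> allows one to
  subtract the contribution of \<open>s\<close>; if there is none, then \<open>s\<close> is redundant.\<close>

lemma bidual_represented:
  assumes "finite S" "S \<subseteq> carrier V" "\<xi> \<in> carrier (dual K (dual K V))"
    and "\<And>l. l \<in> carrier (dual K V) \<Longrightarrow> (\<And>s. s \<in> S \<Longrightarrow> l s = \<zero>\<^bsub>K\<^esub>) \<Longrightarrow> \<xi> l = \<zero>\<^bsub>K\<^esub>"
  shows "\<exists>v\<in>carrier V. \<forall>l\<in>carrier (dual K V). \<xi> l = l v"
  using assms
proof (induction S arbitrary: \<xi> rule: finite_induct)
  case empty
  then show ?case by (intro bexI[of _ "\<zero>\<^bsub>V\<^esub>"]) (auto simp: dual_vanish_zero)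
next
  case (insert s S)
  interpret D: vectorspace K "dual K V" by (rule dual_vectorspace)
  have s: "s \<in> carrier V" and S: "S \<subseteq> carrier V" using insert by auto
  note \<xi> = insert.prems(2)
  show ?case
  proof (cases "s \<in> span S")
    case True
    then have "\<xi> l = \<zero>\<^bsub>K\<^esub>" if "l \<in> carrier (dual K V)" "\<And>t. t \<in> S \<Longrightarrow> l t = \<zero>\<^bsub>K\<^esub>" for l
      using insert.prems(3)[OF that(1)] that dual_vanish_span[OF that(1) S] by blast
    then show ?thesis by (rule insert.IH[OF S \<xi>])
  next
    case False
    obtain l0 where l0: "l0 \<in> carrier (dual K V)" "\<And>u. u \<in> span S \<Longrightarrow> l0 u = \<zero>\<^bsub>K\<^esub>"
      "l0 s = \<one>\<^bsub>K\<^esub>"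
      using separating_functional[OF span_is_submodule[OF S] s False] by blast
    let ?c = "\<xi> l0"
    have c: "?c \<in> carrier K" by (rule D.dualD(2)[OF \<xi> l0(1)])
    \<comment> \<open>\<open>\<mu>\<close> is \<open>\<xi>\<close> minus evaluation at
      \<open>?c\<close> times \<open>s\<close>; the scalar \<open>?c\<close> is the one for which
      \<open>\<mu>\<close> kills \<open>l0\<close>.\<close>
    define \<mu> where "\<mu> = (\<lambda>l\<in>carrier (dual K V). \<xi> l \<ominus>\<^bsub>K\<^esub> ?c \<otimes>\<^bsub>K\<^esub> l s)"
    have \<mu>: "\<mu> \<in> carrier (dual K (dual K V))"
    proof (rule D.dualI)
      show "\<mu> \<in> extensional (carrier (dual K V))" by (simp add: \<mu>_def)
    next
      fix l assume l: "l \<in> carrier (dual K V)"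
      then show "\<mu> l \<in> carrier K" using c D.dualD(2)[OF \<xi> l] dualD(2)[OF l s] by (simp add: \<mu>_def)
      fix l' assume l': "l' \<in> carrier (dual K V)"
      show "\<mu> (l \<oplus>\<^bsub>dual K V\<^esub> l') = \<mu> l \<oplus>\<^bsub>K\<^esub> \<mu> l'"
        using l l' c D.dualD(2)[OF \<xi> l] dualD(2)[OF l s] D.dualD(2)[OF \<xi> l'] dualD(2)[OF l' s]
        by (simp add: \<mu>_def D.dualD(3)[OF \<xi>] dual_apply s R.minus_eq R.r_distr R.minus_add R.a_ac)
    next
      fix a l assume l: "a \<in> carrier K" "l \<in> carrier (dual K V)"
      show "\<mu> (a \<odot>\<^bsub>dual K V\<^esub> l) = a \<otimes>\<^bsub>K\<^esub> \<mu> l"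
        using l c D.dualD(2)[OF \<xi> l(2)] dualD(2)[OF l(2) s]
        by (simp add: \<mu>_def D.dualD(4)[OF \<xi>] dual_apply s R.minus_eq R.r_distr
            R.r_minus R.m_ac)
    qed
    have "\<mu> l = \<zero>\<^bsub>K\<^esub>" if l: "l \<in> carrier (dual K V)" "\<And>t. t \<in> S \<Longrightarrow> l t = \<zero>\<^bsub>K\<^esub>" for l
    proof -
      note ls = dualD(2)[OF l(1) s]
      \<comment> \<open>\<open>?k\<close> corrects \<open>l\<close> by a multiple of
        \<open>l0\<close> so that it vanishes at \<open>s\<close> too, while still vanishing on
        \<open>S\<close>. The hypothesis on \<open>\<xi>\<close> then applies to \<open>?k\<close>,
        and \<open>\<xi> ?k\<close> equals \<open>\<mu> l\<close> up to commutativity of the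
        scalars.\<close>
      let ?k = "l \<oplus>\<^bsub>dual K V\<^esub> (\<ominus>\<^bsub>K\<^esub> l s) \<odot>\<^bsub>dual K V\<^esub> l0"
      have k: "?k \<in> carrier (dual K V)" "(\<ominus>\<^bsub>K\<^esub> l s) \<odot>\<^bsub>dual K V\<^esub> l0 \<in> carrier (dual K V)"
        using l(1) l0(1) ls by auto
      have kv: "?k v = l v \<oplus>\<^bsub>K\<^esub> (\<ominus>\<^bsub>K\<^esub> l s) \<otimes>\<^bsub>K\<^esub> l0 v" if "v \<in> carrier V" for v
        using that by (simp add: dual_apply)
      have "?k t = \<zero>\<^bsub>K\<^esub>" if "t \<in> insert s S" for t
      proof (cases "t = s")
        case True then show ?thesis using kv[OF s] ls l0(3) by (simp add: R.r_neg)
      next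
        case False
        then have "t \<in> S" "t \<in> carrier V" using that S by auto
        moreover then have "t \<in> span S" using in_own_span[OF S] by blast
        ultimately show ?thesis using kv l(2) l0(2) ls by simp
      qed
      then have "\<xi> ?k = \<zero>\<^bsub>K\<^esub>" using insert.prems(3)[OF k(1)] by blast
      then have "\<xi> l \<oplus>\<^bsub>K\<^esub> (\<ominus>\<^bsub>K\<^esub> l s) \<otimes>\<^bsub>K\<^esub> ?c = \<zero>\<^bsub>K\<^esub>"
        using D.dualD(3)[OF \<xi> l(1) k(2)] D.dualD(4)[OF \<xi> _ l0(1)] ls by simp
      then show ?thesis
        using l(1) c ls D.dualD(2)[OF \<xi> l(1)]
        by (simp add: \<mu>_def R.minus_eq R.l_minus R.r_minus R.m_comm)
    qed
    then obtain v where v: "v \<in> carrier V" "\<And>l. l \<in> carrier (dual K V) \<Longrightarrow> \<mu> l = l v"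
      using insert.IH[OF S \<mu>] by blast
    have "\<xi> l = l (v \<oplus>\<^bsub>V\<^esub> ?c \<odot>\<^bsub>V\<^esub> s)" if l: "l \<in> carrier (dual K V)" for l
    proof -
      note cl = c D.dualD(2)[OF \<xi> l] dualD(2)[OF l s]
      have "\<xi> l \<ominus>\<^bsub>K\<^esub> ?c \<otimes>\<^bsub>K\<^esub> l s = l v" using v(2)[OF l] l by (simp add: \<mu>_def)
      then have "l v \<oplus>\<^bsub>K\<^esub> ?c \<otimes>\<^bsub>K\<^esub> l s = \<xi> l"
        using cl by (simp add: R.minus_eq R.a_assoc R.l_neg flip: \<open>_ = l v\<close>)
      then show ?thesis using c s v(1) by (simp add: dualD(3,4)[OF l])
    qed
    then show ?thesis using v(1) c s by (intro bexI[of _ "v \<oplus>\<^bsub>V\<^esub> ?c \<odot>\<^bsub>V\<^esub> s"]) auto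
  qed
qed

text \<open>A functional vanishing on a finite spanning set is zero, so every \<open>\<xi>\<close>
  satisfies the vanishing hypothesis of \<open>bidual_represented\<close>.\<close>

lemma bidual_map_surj:
  assumes fin_dim and \<xi>: "\<xi> \<in> carrier (dual K (dual K V))"
  obtains v where "v \<in> carrier V" "\<xi> = bidual_map K V v"
proof -
  interpret D: vectorspace K "dual K V" by (rule dual_vectorspace)
  obtain S where S: "finite S" "S \<subseteq> carrier V" "span S = carrier V"
    using assms(1) by (auto simp: fin_dim_def)
  have "\<xi> l = \<zero>\<^bsub>K\<^esub>" if l: "l \<in> carrier (dual K V)" "\<And>s. s \<in> S \<Longrightarrow> l s = \<zero>\<^bsub>K\<^esub>" for l
  proof -
    have "l = \<zero>\<^bsub>dual K V\<^esub>"
      using dual_vanish_span[OF l(1) S(2) l(2)] S(3)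
      by (intro dual_ext[OF l(1) D.M.zero_closed]) (auto simp: dual_simps(2))
    then show ?thesis using D.dual_vanish_zero[OF \<xi>] by simp
  qed
  then obtain v where v: "v \<in> carrier V" "\<And>l. l \<in> carrier (dual K V) \<Longrightarrow> \<xi> l = l v"
    using bidual_represented[OF S(1,2) \<xi>] by blast
  then have "\<xi> = bidual_map K V v"
    by (intro D.dual_ext[OF \<xi> bidual_map_closed]) (auto simp: bidual_map_apply)
  then show ?thesis using that v(1) by blast
qed

end

section \<open>Representations, invariants and coinvariants\<close>

lemma (in vectorspace) submodule_abelian_subgroup:
  assumes "submodule K U V"
  shows "abelian_subgroup U V"
proof (rule abelian_subgroupI3)
  show "abelian_group V" by (rule M.abelian_group_axioms)
  show "additive_subgroup U V"
  proof (rule additive_subgroup.intro, rule subgroup.intro)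
    fix x assume "x \<in> U"
    moreover then have "x \<in> carrier V" using submodule.subset[OF assms] by blast
    ultimately have "\<ominus>\<^bsub>V\<^esub> x \<in> U"
      using submodule_minus_closed[OF assms submodule.zero_closed[OF assms]]
      by (metis M.a_inv_closed M.l_zero M.minus_eq)
    then show "inv\<^bsub>add_monoid V\<^esub> x \<in> U" by (simp add: a_inv_def)
  qed (simp_all add: submodule.subset[OF assms] submodule.zero_closed[OF assms]
      submodule.m_closed[OF assms])
qed

lemma quotient_module_simps:
  "carrier (quotient_module V U) = (\<lambda>v. U +>\<^bsub>V\<^esub> v) ` carrier V"
  "\<zero>\<^bsub>quotient_module V U\<^esub> = U" "X \<oplus>\<^bsub>quotient_module V U\<^esub> Y = X <+>\<^bsub>V\<^esub> Y"
  by (auto simp: quotient_module_def A_RCOSETS_def')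

text \<open>A change of names: in the \<open>vectorspace\<close> context above, \<open>K\<close> was
  the field; from here on the field is \<open>C\<close>, and \<open>K\<close> is the subgroup of
  \<open>G\<close> acting on \<open>V\<close>.\<close>

locale finite_representation = vectorspace C V + G: group G
  for C :: "('c, 'r) ring_scheme" and V :: "('c, 'v, 'a) module_scheme"
    and G :: "('g, 'm) monoid_scheme" +
  fixes K :: "'g set" and \<pi> :: "'g \<Rightarrow> 'v \<Rightarrow> 'v"
  assumes K: "subgroup K G"
    and act: "group_action (G\<lparr>carrier := K\<rparr>) (carrier V) \<pi>"
    and lin: "k \<in> K \<Longrightarrow> \<pi> k \<in> lin_maps C V V"
    and finite_dimensional: "fin_dim"
begin

abbreviation "D \<equiv> dual C V"
abbreviation "\<rho> \<equiv> contragredient C G V \<pi>"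

sublocale D: vectorspace C "dual C V"
  by (rule dual_vectorspace)

lemma K_closed [simp]:
  "k \<in> K \<Longrightarrow> k \<in> carrier G" "k \<in> K \<Longrightarrow> inv\<^bsub>G\<^esub> k \<in> K" "\<one>\<^bsub>G\<^esub> \<in> K"
  "k \<in> K \<Longrightarrow> k' \<in> K \<Longrightarrow> k \<otimes>\<^bsub>G\<^esub> k' \<in> K"
  using K by (auto simp: subgroup.mem_carrier subgroup.m_inv_closed subgroup.one_closed subgroup.m_closed)

lemma \<pi>_closed [simp]: "k \<in> K \<Longrightarrow> v \<in> carrier V \<Longrightarrow> \<pi> k v \<in> carrier V"
  by (rule lin_mapsD(2)[OF lin])

lemma \<pi>_add: "k \<in> K \<Longrightarrow> u \<in> carrier V \<Longrightarrow> v \<in> carrier V \<Longrightarrow> \<pi> k (u \<oplus>\<^bsub>V\<^esub> v) = \<pi> k u \<oplus>\<^bsub>V\<^esub> \<pi> k v"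
  by (rule lin_mapsD(3)[OF lin])

lemma \<pi>_smult: "k \<in> K \<Longrightarrow> a \<in> carrier C \<Longrightarrow> v \<in> carrier V \<Longrightarrow> \<pi> k (a \<odot>\<^bsub>V\<^esub> v) = a \<odot>\<^bsub>V\<^esub> \<pi> k v"
  by (rule lin_mapsD(4)[OF lin])

lemma \<pi>_mult: "k \<in> K \<Longrightarrow> k' \<in> K \<Longrightarrow> v \<in> carrier V \<Longrightarrow> \<pi> (k \<otimes>\<^bsub>G\<^esub> k') v = \<pi> k (\<pi> k' v)"
  using group_action.composition_rule[OF act] by simp

lemma \<pi>_one: "v \<in> carrier V \<Longrightarrow> \<pi> \<one>\<^bsub>G\<^esub> v = v"
  using group_action.id_eq_one[OF act, symmetric] by simp

lemma \<rho>_apply: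
  "l \<in> carrier D \<Longrightarrow> v \<in> carrier V \<Longrightarrow> \<rho> k l v = l (\<pi> (inv\<^bsub>G\<^esub> k) v)"
  by (simp add: contragredient_def)

lemma \<rho>_closed [simp]:
  assumes "k \<in> K" "l \<in> carrier D"
  shows "\<rho> k l \<in> carrier D"
  by (rule dualI) (use assms dualD[OF assms(2)] in \<open>auto simp: contragredient_def \<pi>_add \<pi>_smult\<close>)

lemma \<rho>_lin:
  assumes "k \<in> K"
  shows "\<rho> k \<in> lin_maps C D D"
proof (rule lin_mapsI)
  show "\<rho> k \<in> extensional (carrier D)" by (simp add: contragredient_def)
  show "\<rho> k l \<in> carrier D" if "l \<in> carrier D" for l using assms that by simp
  show "\<rho> k (l \<oplus>\<^bsub>D\<^esub> l') = \<rho> k l \<oplus>\<^bsub>D\<^esub> \<rho> k l'" if "l \<in> carrier D" "l' \<in> carrier D" for l l'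
    by (rule dual_ext) (use assms that in \<open>auto simp: \<rho>_apply dual_apply\<close>)
  show "\<rho> k (a \<odot>\<^bsub>D\<^esub> l) = a \<odot>\<^bsub>D\<^esub> \<rho> k l" if "a \<in> carrier C" "l \<in> carrier D" for a l
    by (rule dual_ext) (use assms that in \<open>auto simp: \<rho>_apply dual_apply\<close>)
qed

end

section \<open>Invariant functionals and their pairing with the coinvariants\<close>

locale representation_subgroup = finite_representation C V G K \<pi>
  for C :: "('c, 'r) ring_scheme" and V :: "('c, 'v, 'a) module_scheme"
    and G :: "('g, 'm) monoid_scheme" and K :: "'g set" and \<pi> :: "'g \<Rightarrow> 'v \<Rightarrow> 'v" +
  fixes H :: "'g set"
  assumes H: "subgroup H G" "H \<subseteq> K"
begin

abbreviation "U \<equiv> coinvariants_kernel C V \<pi> H"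
abbreviation "Q \<equiv> coinvariants C V \<pi> H"
abbreviation "cl \<equiv> coinvariant_class C V \<pi> H"
abbreviation "F \<equiv> fixed_vectors D \<rho> H"
abbreviation "e \<equiv> coinvariants_bidual_map C G V \<pi> H"

lemma H_K: "h \<in> H \<Longrightarrow> h \<in> K"
  using H(2) by blast

lemma U_submodule: "submodule C U V"
  unfolding coinvariants_kernel_def
  by (rule span_is_submodule) (use H_K in auto)

sublocale U: abelian_subgroup U V
  by (rule submodule_abelian_subgroup[OF U_submodule])

lemma Q_carrier: "carrier Q = cl ` carrier V"
  by (simp add: coinvariants_def coinvariant_class_def[abs_def] quotient_module_simps)

lemma cl_closed [simp]: "v \<in> carrier V \<Longrightarrow> cl v \<in> carrier Q"
  by (simp add: Q_carrier)

lemma cl_add: "u \<in> carrier V \<Longrightarrow> v \<in> carrier V \<Longrightarrow> cl u \<oplus>\<^bsub>Q\<^esub> cl v = cl (u \<oplus>\<^bsub>V\<^esub> v)"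
  by (simp add: coinvariants_def coinvariant_class_def quotient_module_simps U.a_rcos_sum)

lemma cl_zero: "cl \<zero>\<^bsub>V\<^esub> = \<zero>\<^bsub>Q\<^esub>"
  by (simp add: coinvariants_def coinvariant_class_def quotient_module_simps U.a_subset)

lemma cl_eqI:
  assumes "u \<in> carrier V" "v \<in> carrier V" "u \<ominus>\<^bsub>V\<^esub> v \<in> U"
  shows "cl u = cl v"
  using U.a_repr_independence'[of u v] U.a_rcos_module[of v u] assms
  by (simp add: coinvariant_class_def M.minus_eq)

lemma cl_self: "v \<in> carrier V \<Longrightarrow> v \<in> cl v"
  by (simp add: coinvariant_class_def U.a_rcos_self)

lemma cl_memD:
  assumes "u \<in> cl v" "v \<in> carrier V"
  shows "u \<in> carrier V" "u \<ominus>\<^bsub>V\<^esub> v \<in> U" "cl u = cl v"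
proof -
  show u: "u \<in> carrier V"
    by (rule U.a_elemrcos_carrier[OF assms(2) assms(1)[unfolded coinvariant_class_def]])
  show "u \<ominus>\<^bsub>V\<^esub> v \<in> U"
    using U.a_rcos_module[of v u] u assms by (simp add: coinvariant_class_def M.minus_eq)
  then show "cl u = cl v" by (rule cl_eqI[OF u assms(2)])
qed

text \<open>Gives coset sums in \<open>Q\<close> their meaning; the laws are read off from those of
  \<open>V\<close> through representatives.\<close>

lemma Q_abelian_monoid: "abelian_monoid Q"
proof (rule abelian_monoidI)
  fix X Y Z assume "X \<in> carrier Q" "Y \<in> carrier Q" "Z \<in> carrier Q"
  then obtain x y z where "x \<in> carrier V" "y \<in> carrier V" "z \<in> carrier V"
    "X = cl x" "Y = cl y" "Z = cl z" by (auto simp: Q_carrier)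
  then show "X \<oplus>\<^bsub>Q\<^esub> Y \<oplus>\<^bsub>Q\<^esub> Z = X \<oplus>\<^bsub>Q\<^esub> (Y \<oplus>\<^bsub>Q\<^esub> Z)" by (simp add: cl_add M.a_assoc)
next
  fix X Y assume "X \<in> carrier Q" "Y \<in> carrier Q"
  then obtain x y where "x \<in> carrier V" "y \<in> carrier V" "X = cl x" "Y = cl y"
    by (auto simp: Q_carrier)
  then show "X \<oplus>\<^bsub>Q\<^esub> Y \<in> carrier Q" "X \<oplus>\<^bsub>Q\<^esub> Y = Y \<oplus>\<^bsub>Q\<^esub> X" "\<zero>\<^bsub>Q\<^esub> \<oplus>\<^bsub>Q\<^esub> X = X"
    by (simp_all add: cl_add M.a_comm flip: cl_zero)
qed (simp flip: cl_zero)

text \<open>The contragredient acts through inverses, but \<open>H\<close> is stable under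
  inversion, so invariance can be stated with \<open>\<pi>\<close> itself.\<close>

lemma F_iff: "l \<in> carrier F \<longleftrightarrow> l \<in> carrier D \<and> (\<forall>h\<in>H. \<forall>v\<in>carrier V. l (\<pi> h v) = l v)"
proof -
  have *: "(\<forall>h\<in>H. \<rho> h l = l) = (\<forall>h\<in>H. \<forall>v\<in>carrier V. l (\<pi> h v) = l v)" if l: "l \<in> carrier D"
  proof (intro iffI ballI)
    fix h v assume "\<forall>h\<in>H. \<rho> h l = l" "h \<in> H" "v \<in> carrier V"
    then have "\<rho> (inv\<^bsub>G\<^esub> h) l v = l v" using subgroup.m_inv_closed[OF H(1)] by simp
    then show "l (\<pi> h v) = l v" using \<open>h \<in> H\<close> \<open>v \<in> carrier V\<close> H_K l by (simp add: \<rho>_apply)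
  next
    fix h assume *: "\<forall>h\<in>H. \<forall>v\<in>carrier V. l (\<pi> h v) = l v" "h \<in> H"
    then have "inv\<^bsub>G\<^esub> h \<in> H" "h \<in> K" using subgroup.m_inv_closed[OF H(1)] H_K by blast+
    then show "\<rho> h l = l" using l * by (intro dual_ext) (auto simp: \<rho>_apply)
  qed
  show ?thesis by (simp add: fixed_vectors_def * cong: conj_cong)
qed

lemma F_simps: "\<zero>\<^bsub>F\<^esub> = \<zero>\<^bsub>D\<^esub>" "l \<oplus>\<^bsub>F\<^esub> l' = l \<oplus>\<^bsub>D\<^esub> l'" "a \<odot>\<^bsub>F\<^esub> l = a \<odot>\<^bsub>D\<^esub> l"
  by (simp_all add: fixed_vectors_def)

lemma F_D: "l \<in> carrier F \<Longrightarrow> l \<in> carrier D"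
  by (simp add: F_iff)

text \<open>Together with \<open>vanish_U_F\<close> this identifies \<open>F\<close> with the
  annihilator of \<open>U\<close>. An invariant functional kills the generators of \<open>U\<close>,
  hence their span.\<close>

lemma F_vanish_U:
  assumes "l \<in> carrier F" "u \<in> U"
  shows "l u = \<zero>\<^bsub>C\<^esub>"
proof (rule dual_vanish_span[OF F_D[OF assms(1)] _ _ assms(2)[unfolded coinvariants_kernel_def]])
  show "{\<pi> h v \<ominus>\<^bsub>V\<^esub> v |h v. h \<in> H \<and> v \<in> carrier V} \<subseteq> carrier V" using H_K by auto
  fix s assume "s \<in> {\<pi> h v \<ominus>\<^bsub>V\<^esub> v |h v. h \<in> H \<and> v \<in> carrier V}"
  then obtain h v where hv: "h \<in> H" "v \<in> carrier V" "s = \<pi> h v \<ominus>\<^bsub>V\<^esub> v" by blast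
  moreover have "h \<in> K" using hv H by blast
  ultimately show "l s = \<zero>\<^bsub>C\<^esub>"
    using assms(1) dualD(2)[OF F_D[OF assms(1)], of v]
    by (simp add: dual_minus F_iff R.minus_eq R.r_neg)
qed

lemma \<pi>_minus_U:
  assumes "h \<in> H" "v \<in> carrier V"
  shows "\<pi> h v \<ominus>\<^bsub>V\<^esub> v \<in> U"
proof -
  have "{\<pi> h v \<ominus>\<^bsub>V\<^esub> v |h v. h \<in> H \<and> v \<in> carrier V} \<subseteq> carrier V" using H_K by auto
  from in_own_span[OF this] show ?thesis
    using assms unfolding coinvariants_kernel_def by blast
qed

text \<open>Turns a functional separating a vector from \<open>U\<close> into an invariant one,
  which is how it becomes usable as an argument of \<open>e\<close>.\<close>

lemma vanish_U_F:
  assumes l: "l \<in> carrier D" and van: "\<And>u. u \<in> U \<Longrightarrow> l u = \<zero>\<^bsub>C\<^esub>"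
  shows "l \<in> carrier F"
  unfolding F_iff
proof (intro conjI ballI)
  fix h v assume hv: "h \<in> H" "v \<in> carrier V"
  then have k: "h \<in> K" using H by blast
  have "\<pi> h v \<ominus>\<^bsub>V\<^esub> v \<in> U" by (rule \<pi>_minus_U[OF hv])
  then have "l (\<pi> h v) \<ominus>\<^bsub>C\<^esub> l v = \<zero>\<^bsub>C\<^esub>"
    using van dual_minus[OF l \<pi>_closed[OF k hv(2)] hv(2)] by simp
  then show "l (\<pi> h v) = l v" using dualD(2)[OF l] k hv by simp
qed (rule l)

text \<open>Justifies the \<open>the_elem\<close> in \<open>coinvariants_bidual_map\<close>: members
  of one class differ by an element of \<open>U\<close>, which \<open>l\<close> annihilates.\<close>

lemma F_image_cl:
  assumes "l \<in> carrier F" "v \<in> carrier V"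
  shows "l ` cl v = {l v}"
proof -
  have "l u = l v" if "u \<in> cl v" for u
  proof -
    note u = cl_memD[OF that assms(2)]
    have "l u \<ominus>\<^bsub>C\<^esub> l v = \<zero>\<^bsub>C\<^esub>"
      using F_vanish_U[OF assms(1) u(2)] dual_minus[OF F_D[OF assms(1)] u(1) assms(2)] by simp
    then show ?thesis using dualD(2)[OF F_D[OF assms(1)]] u(1) assms(2) by simp
  qed
  then show ?thesis using cl_self[OF assms(2)] by blast
qed

lemma e_apply: "l \<in> carrier F \<Longrightarrow> v \<in> carrier V \<Longrightarrow> e (cl v) l = l v"
  by (simp add: coinvariants_bidual_map_def F_image_cl)

text \<open>If \<open>u - v\<close> were outside \<open>U\<close>, a functional vanishing on
  \<open>U\<close> with value one at \<open>u - v\<close> would lie in \<open>F\<close> and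
  distinguish the images of the two classes.\<close>

lemma e_inj: "inj_on e (carrier Q)"
proof (rule inj_onI)
  fix X Y assume "X \<in> carrier Q" "Y \<in> carrier Q" and eq: "e X = e Y"
  then obtain u v where uv: "u \<in> carrier V" "v \<in> carrier V" "X = cl u" "Y = cl v"
    by (auto simp: Q_carrier)
  have "u \<ominus>\<^bsub>V\<^esub> v \<in> U"
  proof (rule ccontr)
    assume "u \<ominus>\<^bsub>V\<^esub> v \<notin> U"
    then obtain l where l: "l \<in> carrier D" "\<And>w. w \<in> U \<Longrightarrow> l w = \<zero>\<^bsub>C\<^esub>" "l (u \<ominus>\<^bsub>V\<^esub> v) = \<one>\<^bsub>C\<^esub>"
      using separating_functional[OF U_submodule, of "u \<ominus>\<^bsub>V\<^esub> v"] uv(1,2) by blast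
    have "l u = l v"
      using e_apply[OF vanish_U_F[OF l(1,2)] uv(1)] e_apply[OF vanish_U_F[OF l(1,2)] uv(2)] eq uv(3,4)
      by simp
    then show False using l(3) dual_minus[OF l(1) uv(1,2)] dualD(2)[OF l(1) uv(2)]
      by (simp add: R.minus_eq R.r_neg)
  qed
  then show "X = Y" using cl_eqI uv by simp
qed

lemma F_closed:
  "l \<in> carrier F \<Longrightarrow> l' \<in> carrier F \<Longrightarrow> l \<oplus>\<^bsub>D\<^esub> l' \<in> carrier F"
  "a \<in> carrier C \<Longrightarrow> l \<in> carrier F \<Longrightarrow> a \<odot>\<^bsub>D\<^esub> l \<in> carrier F"
  "\<zero>\<^bsub>D\<^esub> \<in> carrier F"
  using H_K by (auto simp: F_iff dual_apply)

text \<open>\<open>transpose_map\<close> is restricted to the dual of \<open>F\<close>, so it can be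
  evaluated at \<open>e (cl v)\<close> only after this.\<close>

lemma e_closed:
  assumes "v \<in> carrier V"
  shows "e (cl v) \<in> carrier (dual C F)"
  unfolding dual_carrier
proof (rule lin_mapsI)
  show "e (cl v) \<in> extensional (carrier F)" by (simp add: coinvariants_bidual_map_def)
qed (use assms in \<open>auto simp: e_apply F_simps F_closed dual_apply dualD(2)[OF F_D]\<close>)

end

section \<open>Hecke algebras and the transpose\<close>

lemma double_coset_iff:
  "x \<in> double_coset G K g \<longleftrightarrow> (\<exists>k\<in>K. \<exists>k'\<in>K. x = k \<otimes>\<^bsub>G\<^esub> (g \<otimes>\<^bsub>G\<^esub> k'))"
  by (auto simp: double_coset_def set_mult_def l_coset_def)

lemma hecke_carrierD:
  assumes "\<Phi> \<in> carrier (hecke_algebra C G K W \<rho>)"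
  shows "\<Phi> \<in> extensional (carrier G)"
    "g \<in> carrier G \<Longrightarrow> \<Phi> g \<in> lin_maps C W W"
    "x \<in> K \<Longrightarrow> g \<in> carrier G \<Longrightarrow> y \<in> K \<Longrightarrow> w \<in> carrier W \<Longrightarrow> \<rho> y w \<in> carrier W \<Longrightarrow>
      \<Phi> (x \<otimes>\<^bsub>G\<^esub> g \<otimes>\<^bsub>G\<^esub> y) w = \<rho> x (\<Phi> g (\<rho> y w))"
    "\<exists>F. finite F \<and> F \<subseteq> carrier G \<and>
      {g \<in> carrier G. \<Phi> g \<noteq> (\<lambda>w\<in>carrier W. \<zero>\<^bsub>W\<^esub>)} = (\<Union>g\<in>F. double_coset G K g)"
  using assms by (auto simp: hecke_algebra_def compose_def PiE_def Pi_iff)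

text \<open>Reduces equivariance to values on vectors. That \<open>\<Phi>\<close> at the translated
  point is extensional follows from its being one of the \<open>lin_maps\<close>, which requires the
  translate to stay in \<open>carrier G\<close>.\<close>

lemma hecke_carrierI:
  assumes "\<Phi> \<in> extensional (carrier G)"
    and "\<And>g. g \<in> carrier G \<Longrightarrow> \<Phi> g \<in> lin_maps C W W"
    and "\<And>x g y w. x \<in> K \<Longrightarrow> g \<in> carrier G \<Longrightarrow> y \<in> K \<Longrightarrow> w \<in> carrier W \<Longrightarrow>
      \<Phi> (x \<otimes>\<^bsub>G\<^esub> g \<otimes>\<^bsub>G\<^esub> y) w = \<rho> x (\<Phi> g (\<rho> y w))"
    and "\<And>x g y. x \<in> K \<Longrightarrow> g \<in> carrier G \<Longrightarrow> y \<in> K \<Longrightarrow> x \<otimes>\<^bsub>G\<^esub> g \<otimes>\<^bsub>G\<^esub> y \<in> carrier G"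
    and "\<And>y w. y \<in> K \<Longrightarrow> w \<in> carrier W \<Longrightarrow> \<rho> y w \<in> carrier W"
    and "finite F" "F \<subseteq> carrier G"
      "{g \<in> carrier G. \<Phi> g \<noteq> (\<lambda>w\<in>carrier W. \<zero>\<^bsub>W\<^esub>)} = (\<Union>g\<in>F. double_coset G K g)"
  shows "\<Phi> \<in> carrier (hecke_algebra C G K W \<rho>)"
proof -
  have "\<Phi> (x \<otimes>\<^bsub>G\<^esub> g \<otimes>\<^bsub>G\<^esub> y)
      = compose (carrier W) (\<rho> x) (compose (carrier W) (\<Phi> g) (\<rho> y))"
    if "x \<in> K" "g \<in> carrier G" "y \<in> K" for x g y
  proof (rule extensionalityI[of _ "carrier W"])
    show "\<Phi> (x \<otimes>\<^bsub>G\<^esub> g \<otimes>\<^bsub>G\<^esub> y) \<in> extensional (carrier W)"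
      by (rule lin_mapsD(1)[OF assms(2)[OF assms(4)[OF that]]])
    show "compose (carrier W) (\<rho> x) (compose (carrier W) (\<Phi> g) (\<rho> y)) \<in> extensional (carrier W)"
      by (rule compose_extensional)
    fix w assume "w \<in> carrier W"
    then show "\<Phi> (x \<otimes>\<^bsub>G\<^esub> g \<otimes>\<^bsub>G\<^esub> y) w
        = compose (carrier W) (\<rho> x) (compose (carrier W) (\<Phi> g) (\<rho> y)) w"
      using assms(3)[OF that] by (simp add: compose_def)
  qed
  moreover have "\<Phi> \<in> carrier G \<rightarrow>\<^sub>E lin_maps C W W"
    using assms(1,2) by (simp add: PiE_def)
  ultimately show ?thesis
    using assms(6-8) by (auto simp: hecke_algebra_def)
qed

section \<open>The transpose carries the Hecke algebra of the dual to that of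
  \<open>V\<close>\<close>

context finite_representation
begin

context
  fixes \<Phi>
  assumes \<Phi>: "\<Phi> \<in> carrier (hecke_dual C G K V \<pi>)"
begin

lemmas hecke_dualD = hecke_carrierD[OF \<Phi>[unfolded hecke_dual_def]]

lemma \<Phi>_closed [simp]: "g \<in> carrier G \<Longrightarrow> l \<in> carrier D \<Longrightarrow> \<Phi> g l \<in> carrier D"
  by (rule lin_mapsD(2)[OF hecke_dualD(2)])

lemma \<Phi>_add:
  "g \<in> carrier G \<Longrightarrow> l \<in> carrier D \<Longrightarrow> l' \<in> carrier D \<Longrightarrow> \<Phi> g (l \<oplus>\<^bsub>D\<^esub> l') = \<Phi> g l \<oplus>\<^bsub>D\<^esub> \<Phi> g l'"
  by (rule lin_mapsD(3)[OF hecke_dualD(2)])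

lemma \<Phi>_smult:
  "g \<in> carrier G \<Longrightarrow> a \<in> carrier C \<Longrightarrow> l \<in> carrier D \<Longrightarrow> \<Phi> g (a \<odot>\<^bsub>D\<^esub> l) = a \<odot>\<^bsub>D\<^esub> \<Phi> g l"
  by (rule lin_mapsD(4)[OF hecke_dualD(2)])

lemma \<Phi>_equivariant:
  assumes "x \<in> K" "g \<in> carrier G" "y \<in> K" "l \<in> carrier D"
  shows "\<Phi> (x \<otimes>\<^bsub>G\<^esub> g \<otimes>\<^bsub>G\<^esub> y) l = \<rho> x (\<Phi> g (\<rho> y l))"
  using hecke_dualD(3) assms by simp

lemma \<Phi>_zero_iff:
  assumes "g \<in> carrier G"
  shows "\<Phi> g = (\<lambda>l\<in>carrier D. \<zero>\<^bsub>D\<^esub>)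
    \<longleftrightarrow> (\<forall>l\<in>carrier D. \<forall>v\<in>carrier V. \<Phi> g l v = \<zero>\<^bsub>C\<^esub>)"
proof (intro iffI ballI)
  assume *: "\<forall>l\<in>carrier D. \<forall>v\<in>carrier V. \<Phi> g l v = \<zero>\<^bsub>C\<^esub>"
  show "\<Phi> g = (\<lambda>l\<in>carrier D. \<zero>\<^bsub>D\<^esub>)"
  proof (rule extensionalityI[OF lin_mapsD(1)[OF hecke_dualD(2)[OF assms]] restrict_extensional])
    fix l assume l: "l \<in> carrier D"
    have "\<Phi> g l = \<zero>\<^bsub>D\<^esub>"
      by (rule dual_ext) (use * l assms in \<open>auto simp: dual_apply\<close>)
    then show "\<Phi> g l = (\<lambda>l\<in>carrier D. \<zero>\<^bsub>D\<^esub>) l" using l by simp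
  qed
qed (simp add: dual_apply)

text \<open>The transpose of \<open>\<Phi>\<close> at the inverse of \<open>g\<close> sends
  evaluation at \<open>v\<close> to a functional \<open>?\<xi>\<close> on the dual, and finite
  dimension makes \<open>?\<xi>\<close> an evaluation at some \<open>u\<close>. This resolves the
  \<open>inv_into\<close> in the definition; linearity, equivariance and support of
  \<open>iota\<close> then follow from the pairing formula.\<close>

lemma iota_characterization:
  assumes g: "g \<in> carrier G" and v: "v \<in> carrier V"
  shows "iota C G K V \<pi> \<Phi> g v \<in> carrier V \<and>
    (\<forall>l\<in>carrier D. l (iota C G K V \<pi> \<Phi> g v) = \<Phi> (inv\<^bsub>G\<^esub> g) l v)"
proof -
  let ?\<xi> = "transpose_map C D (\<Phi> (inv\<^bsub>G\<^esub> g)) (bidual_map C V v)"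
  have \<xi>_apply: "?\<xi> l = \<Phi> (inv\<^bsub>G\<^esub> g) l v" if "l \<in> carrier D" for l
    using that g v by (simp add: transpose_map_def bidual_map_closed bidual_map_apply)
  have "?\<xi> \<in> carrier (dual C D)"
  proof (rule D.dualI)
    show "?\<xi> \<in> extensional (carrier D)"
      using bidual_map_closed[OF v] by (simp add: transpose_map_def)
  qed (use g v in \<open>auto simp: \<xi>_apply \<Phi>_add \<Phi>_smult dual_apply dualD(2)[OF \<Phi>_closed]\<close>)
  then obtain u where u: "u \<in> carrier V" "?\<xi> = bidual_map C V u"
    using bidual_map_surj[OF finite_dimensional] by blast
  have "iota C G K V \<pi> \<Phi> g v = inv_into (carrier V) (bidual_map C V) ?\<xi>"
    using g v \<Phi> by (simp add: iota_def hecke_transpose_def)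
  also have "\<dots> = u"
    unfolding u(2) by (rule inv_into_f_f[OF bidual_map_inj u(1)])
  finally have "iota C G K V \<pi> \<Phi> g v = u" .
  moreover have "l u = \<Phi> (inv\<^bsub>G\<^esub> g) l v" if "l \<in> carrier D" for l
    using \<xi>_apply[OF that] unfolding u(2) by (simp add: bidual_map_apply[OF that])
  ultimately show ?thesis using u(1) by simp
qed

lemma iota_closed [simp]:
  "g \<in> carrier G \<Longrightarrow> v \<in> carrier V \<Longrightarrow> iota C G K V \<pi> \<Phi> g v \<in> carrier V"
  using iota_characterization by blast

lemma iota_apply:
  "g \<in> carrier G \<Longrightarrow> v \<in> carrier V \<Longrightarrow> l \<in> carrier D \<Longrightarrow>
    l (iota C G K V \<pi> \<Phi> g v) = \<Phi> (inv\<^bsub>G\<^esub> g) l v"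
  using iota_characterization by blast

lemma iota_ext:
  "g \<in> carrier G \<Longrightarrow> iota C G K V \<pi> \<Phi> g \<in> extensional (carrier V)"
  "iota C G K V \<pi> \<Phi> \<in> extensional (carrier G)"
  using \<Phi> by (simp_all add: iota_def hecke_transpose_def)

lemma iota_lin:
  assumes g: "g \<in> carrier G"
  shows "iota C G K V \<pi> \<Phi> g \<in> lin_maps C V V"
proof (rule lin_mapsI)
  fix u v assume uv: "u \<in> carrier V" "v \<in> carrier V"
  show "iota C G K V \<pi> \<Phi> g (u \<oplus>\<^bsub>V\<^esub> v)
      = iota C G K V \<pi> \<Phi> g u \<oplus>\<^bsub>V\<^esub> iota C G K V \<pi> \<Phi> g v"
  proof (rule functionals_separate)
    fix l assume l: "l \<in> carrier D"
    then have "\<Phi> (inv\<^bsub>G\<^esub> g) l \<in> carrier D" using g by simp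
    then show "l (iota C G K V \<pi> \<Phi> g (u \<oplus>\<^bsub>V\<^esub> v))
        = l (iota C G K V \<pi> \<Phi> g u \<oplus>\<^bsub>V\<^esub> iota C G K V \<pi> \<Phi> g v)"
      using g uv l by (simp add: iota_apply dualD(3)[OF l] dualD(3)[of "\<Phi> (inv\<^bsub>G\<^esub> g) l"])
  qed (use g uv in auto)
next
  fix a v assume av: "a \<in> carrier C" "v \<in> carrier V"
  show "iota C G K V \<pi> \<Phi> g (a \<odot>\<^bsub>V\<^esub> v) = a \<odot>\<^bsub>V\<^esub> iota C G K V \<pi> \<Phi> g v"
  proof (rule functionals_separate)
    fix l assume l: "l \<in> carrier D"
    then have "\<Phi> (inv\<^bsub>G\<^esub> g) l \<in> carrier D" using g by simp
    then show "l (iota C G K V \<pi> \<Phi> g (a \<odot>\<^bsub>V\<^esub> v)) = l (a \<odot>\<^bsub>V\<^esub> iota C G K V \<pi> \<Phi> g v)"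
      using g av l by (simp add: iota_apply dualD(4)[OF l] dualD(4)[of "\<Phi> (inv\<^bsub>G\<^esub> g) l"])
  qed (use g av in auto)
qed (use g iota_ext in auto)

text \<open>Inverting \<open>x g y\<close> reverses the order of the factors and transposing
  reverses it back, while the inverses of \<open>x\<close> and \<open>y\<close> are undone by those
  in the contragredient action.\<close>

lemma iota_equivariant:
  assumes x: "x \<in> K" and g: "g \<in> carrier G" and y: "y \<in> K" and v: "v \<in> carrier V"
  shows "iota C G K V \<pi> \<Phi> (x \<otimes>\<^bsub>G\<^esub> g \<otimes>\<^bsub>G\<^esub> y) v = \<pi> x (iota C G K V \<pi> \<Phi> g (\<pi> y v))"
proof (rule functionals_separate)
  fix l assume l: "l \<in> carrier D"
  have i: "inv\<^bsub>G\<^esub> (x \<otimes>\<^bsub>G\<^esub> g \<otimes>\<^bsub>G\<^esub> y) = inv\<^bsub>G\<^esub> y \<otimes>\<^bsub>G\<^esub> inv\<^bsub>G\<^esub> g \<otimes>\<^bsub>G\<^esub> inv\<^bsub>G\<^esub> x"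
    using x g y by (simp add: G.inv_mult_group G.m_assoc)
  have "l (iota C G K V \<pi> \<Phi> (x \<otimes>\<^bsub>G\<^esub> g \<otimes>\<^bsub>G\<^esub> y) v)
      = \<rho> (inv\<^bsub>G\<^esub> y) (\<Phi> (inv\<^bsub>G\<^esub> g) (\<rho> (inv\<^bsub>G\<^esub> x) l)) v"
    using x g y v l by (simp add: iota_apply i \<Phi>_equivariant)
  also have "\<dots> = \<Phi> (inv\<^bsub>G\<^esub> g) (\<rho> (inv\<^bsub>G\<^esub> x) l) (\<pi> y v)"
    using x g y v l by (simp add: \<rho>_apply)
  also have "\<dots> = \<rho> (inv\<^bsub>G\<^esub> x) l (iota C G K V \<pi> \<Phi> g (\<pi> y v))"
    using x g y v l by (simp add: iota_apply)
  also have "\<dots> = l (\<pi> x (iota C G K V \<pi> \<Phi> g (\<pi> y v)))"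
    using x g y v l by (simp add: \<rho>_apply)
  finally show "l (iota C G K V \<pi> \<Phi> (x \<otimes>\<^bsub>G\<^esub> g \<otimes>\<^bsub>G\<^esub> y) v) = \<dots>" .
qed (use x g y v in auto)

text \<open>Both sides say that all the pairings of functionals with values of \<open>iota\<close>
  at \<open>g\<close> vanish.\<close>

lemma iota_zero_iff:
  assumes g: "g \<in> carrier G"
  shows "iota C G K V \<pi> \<Phi> g = (\<lambda>v\<in>carrier V. \<zero>\<^bsub>V\<^esub>)
    \<longleftrightarrow> \<Phi> (inv\<^bsub>G\<^esub> g) = (\<lambda>l\<in>carrier D. \<zero>\<^bsub>D\<^esub>)"
proof -
  have "iota C G K V \<pi> \<Phi> g = (\<lambda>v\<in>carrier V. \<zero>\<^bsub>V\<^esub>)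
      \<longleftrightarrow> (\<forall>v\<in>carrier V. \<forall>l\<in>carrier D. l (iota C G K V \<pi> \<Phi> g v) = \<zero>\<^bsub>C\<^esub>)"
  proof (intro iffI ballI)
    assume *: "\<forall>v\<in>carrier V. \<forall>l\<in>carrier D. l (iota C G K V \<pi> \<Phi> g v) = \<zero>\<^bsub>C\<^esub>"
    show "iota C G K V \<pi> \<Phi> g = (\<lambda>v\<in>carrier V. \<zero>\<^bsub>V\<^esub>)"
    proof (rule extensionalityI[OF iota_ext(1)[OF g] restrict_extensional])
      fix v assume v: "v \<in> carrier V"
      have "iota C G K V \<pi> \<Phi> g v = \<zero>\<^bsub>V\<^esub>"
        by (rule functionals_separate) (use * v g in \<open>auto simp: dual_vanish_zero\<close>)
      then show "iota C G K V \<pi> \<Phi> g v = (\<lambda>v\<in>carrier V. \<zero>\<^bsub>V\<^esub>) v" using v by simp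
    qed
  qed (simp add: dual_vanish_zero)
  also have "\<dots> \<longleftrightarrow> (\<forall>l\<in>carrier D. \<forall>v\<in>carrier V. \<Phi> (inv\<^bsub>G\<^esub> g) l v = \<zero>\<^bsub>C\<^esub>)"
    using iota_apply[OF g] by auto
  also have "\<dots> \<longleftrightarrow> \<Phi> (inv\<^bsub>G\<^esub> g) = (\<lambda>l\<in>carrier D. \<zero>\<^bsub>D\<^esub>)"
    using \<Phi>_zero_iff[of "inv\<^bsub>G\<^esub> g"] g by simp
  finally show ?thesis .
qed

text \<open>One inclusion suffices: the reverse one is this lemma applied to the inverses of
  \<open>g\<close> and \<open>f\<close>.\<close>

lemma inv_double_coset:
  assumes "g \<in> carrier G" "f \<in> carrier G" "inv\<^bsub>G\<^esub> g \<in> double_coset G K f"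
  shows "g \<in> double_coset G K (inv\<^bsub>G\<^esub> f)"
proof -
  obtain k k' where k: "k \<in> K" "k' \<in> K" "inv\<^bsub>G\<^esub> g = k \<otimes>\<^bsub>G\<^esub> (f \<otimes>\<^bsub>G\<^esub> k')"
    using assms(3) by (auto simp: double_coset_iff)
  then have "g = inv\<^bsub>G\<^esub> (k \<otimes>\<^bsub>G\<^esub> (f \<otimes>\<^bsub>G\<^esub> k'))" using assms(1) by (metis G.inv_inv)
  also have "\<dots> = inv\<^bsub>G\<^esub> k' \<otimes>\<^bsub>G\<^esub> (inv\<^bsub>G\<^esub> f \<otimes>\<^bsub>G\<^esub> inv\<^bsub>G\<^esub> k)"
    using k(1,2) assms(2) by (simp add: G.inv_mult_group G.m_assoc)
  finally show ?thesis using k(1,2) K_closed(2) unfolding double_coset_iff by blast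
qed

text \<open>The support of the transpose is the inverse of the support of \<open>\<Phi>\<close>, so
  inverses of representatives of double cosets represent it.\<close>

lemma iota_hecke: "iota C G K V \<pi> \<Phi> \<in> carrier (hecke_algebra C G K V \<pi>)"
proof -
  obtain F where F: "finite F" "F \<subseteq> carrier G"
    "{g \<in> carrier G. \<Phi> g \<noteq> (\<lambda>l\<in>carrier D. \<zero>\<^bsub>D\<^esub>)} = (\<Union>g\<in>F. double_coset G K g)"
    using hecke_dualD(4) by blast
  have "{g \<in> carrier G. iota C G K V \<pi> \<Phi> g \<noteq> (\<lambda>v\<in>carrier V. \<zero>\<^bsub>V\<^esub>)}
      = {g \<in> carrier G. inv\<^bsub>G\<^esub> g \<in> (\<Union>f\<in>F. double_coset G K f)}"
    unfolding F(3)[symmetric] using iota_zero_iff by auto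
  also have "\<dots> = (\<Union>f\<in>(\<lambda>f. inv\<^bsub>G\<^esub> f) ` F. double_coset G K f)"
  proof (intro equalityI subsetI)
    fix g assume "g \<in> {g \<in> carrier G. inv\<^bsub>G\<^esub> g \<in> (\<Union>f\<in>F. double_coset G K f)}"
    then show "g \<in> (\<Union>f\<in>(\<lambda>f. inv\<^bsub>G\<^esub> f) ` F. double_coset G K f)"
      using inv_double_coset F(2) by blast
  next
    fix g assume "g \<in> (\<Union>f\<in>(\<lambda>f. inv\<^bsub>G\<^esub> f) ` F. double_coset G K f)"
    then obtain f where f: "f \<in> F" "g \<in> double_coset G K (inv\<^bsub>G\<^esub> f)" by blast
    then have fG: "f \<in> carrier G" using F(2) by blast
    then have gG: "g \<in> carrier G" using f(2) by (auto simp: double_coset_iff)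
    have "inv\<^bsub>G\<^esub> g \<in> double_coset G K f"
      using inv_double_coset[of "inv\<^bsub>G\<^esub> g" "inv\<^bsub>G\<^esub> f"] f gG fG by simp
    then show "g \<in> {g \<in> carrier G. inv\<^bsub>G\<^esub> g \<in> (\<Union>f\<in>F. double_coset G K f)}"
      using f(1) gG by blast
  qed
  finally show ?thesis
    using F(1,2)
    by (intro hecke_carrierI[where F = "(\<lambda>f. inv\<^bsub>G\<^esub> f) ` F"])
       (auto simp: iota_ext iota_lin iota_equivariant)
qed

end

end

section \<open>The two Satake maps\<close>

text \<open>Common pattern behind translation, conjugation and inversion of cosets. Injectivity on
  the family comes from injectivity of \<open>\<theta>\<close> on \<open>N\<close>, since the cosets
  are subsets of \<open>N\<close>. \<open>A\<close> and \<open>B\<close> differ when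
  \<open>\<theta>\<close> is inversion, which exchanges right and left cosets.\<close>

lemma coset_family_transform:
  assumes \<theta>: "bij_betw \<theta> N N" and A: "\<And>n. n \<in> N \<Longrightarrow> A n \<subseteq> N"
    and AB: "\<And>n. n \<in> N \<Longrightarrow> \<theta> ` A n = B (\<theta> n)"
  shows "inj_on ((`) \<theta>) (A ` N)" "(`) \<theta> ` A ` N = B ` N"
proof -
  have "inj_on ((`) \<theta>) (Pow N)" using \<theta> by (simp add: bij_betw_def inj_on_image_Pow)
  then show "inj_on ((`) \<theta>) (A ` N)" by (rule inj_on_subset) (use A in blast)
  have "(`) \<theta> ` A ` N = B ` \<theta> ` N" using AB by (auto simp: image_iff)
  then show "(`) \<theta> ` A ` N = B ` N" using \<theta> by (simp add: bij_betw_def)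
qed

lemma (in group) inv_cancel_left:
  "a \<in> carrier G \<Longrightarrow> b \<in> carrier G \<Longrightarrow> inv a \<otimes> (a \<otimes> b) = b"
  "a \<in> carrier G \<Longrightarrow> b \<in> carrier G \<Longrightarrow> a \<otimes> (inv a \<otimes> b) = b"
  by (simp_all flip: m_assoc)

locale satake_datum = finite_representation C V G K \<pi>
  for C :: "('c, 'r) ring_scheme" and V :: "('c, 'v, 'a) module_scheme"
    and G :: "('g, 'm) monoid_scheme" and K :: "'g set" and \<pi> :: "'g \<Rightarrow> 'v \<Rightarrow> 'v" +
  fixes P N M :: "'g set"
  assumes PNM: "semidirect_product G P N M"
    and PNM_K: "semidirect_product G (P \<inter> K) (N \<inter> K) (M \<inter> K)"
    and finite_right: "g \<in> carrier G \<Longrightarrow> \<exists>F. finite F \<and> F \<subseteq> carrier G \<and>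
      double_coset G K g = (\<Union>g'\<in>F. K #>\<^bsub>G\<^esub> g')"
    and finite_left: "g \<in> carrier G \<Longrightarrow> \<exists>F. finite F \<and> F \<subseteq> carrier G \<and>
      double_coset G K g = (\<Union>g''\<in>F. g'' <#\<^bsub>G\<^esub> K)"
begin

abbreviation "H \<equiv> N \<inter> K"

lemma P: "subgroup P G"
  using PNM by (simp add: semidirect_product_def)

lemma N_normal: "normal N (G\<lparr>carrier := P\<rparr>)"
  using PNM by (simp add: semidirect_product_def)

lemma M_P: "subgroup M (G\<lparr>carrier := P\<rparr>)"
  using PNM by (simp add: semidirect_product_def)

lemma N: "subgroup N G"
  using G.incl_subgroup[OF P normal_imp_subgroup[OF N_normal]] .

lemma M: "subgroup M G"
  using G.incl_subgroup[OF P M_P] .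

lemma NM_subset: "N \<subseteq> P" "M \<subseteq> P"
  using subgroup.subset[OF normal_imp_subgroup[OF N_normal]] subgroup.subset[OF M_P] by auto

lemma N_closed [simp]:
  "n \<in> N \<Longrightarrow> n \<in> carrier G" "n \<in> N \<Longrightarrow> inv\<^bsub>G\<^esub> n \<in> N" "\<one>\<^bsub>G\<^esub> \<in> N"
  "n \<in> N \<Longrightarrow> n' \<in> N \<Longrightarrow> n \<otimes>\<^bsub>G\<^esub> n' \<in> N"
  using subgroup.mem_carrier[OF N] subgroup.m_inv_closed[OF N] subgroup.one_closed[OF N]
    subgroup.m_closed[OF N] by auto

lemma M_closed [simp]:
  "m \<in> M \<Longrightarrow> m \<in> carrier G" "m \<in> M \<Longrightarrow> inv\<^bsub>G\<^esub> m \<in> M" "\<one>\<^bsub>G\<^esub> \<in> M"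
  "m \<in> M \<Longrightarrow> m' \<in> M \<Longrightarrow> m \<otimes>\<^bsub>G\<^esub> m' \<in> M"
  using subgroup.mem_carrier[OF M] subgroup.m_inv_closed[OF M] subgroup.one_closed[OF M]
    subgroup.m_closed[OF M] by auto

lemma N_conj:
  assumes "p \<in> P" "n \<in> N"
  shows "p \<otimes>\<^bsub>G\<^esub> n \<otimes>\<^bsub>G\<^esub> inv\<^bsub>G\<^esub> p \<in> N" "inv\<^bsub>G\<^esub> p \<otimes>\<^bsub>G\<^esub> n \<otimes>\<^bsub>G\<^esub> p \<in> N"
  using normal.inv_op_closed2[OF N_normal, of p n] normal.inv_op_closed1[OF N_normal, of p n]
    G.m_inv_consistent[OF P assms(1)] assms by auto

lemma H_subgroup: "subgroup H G"
  by (rule G.subgroups_Inter_pair[OF N K])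

sublocale representation_subgroup C V G K \<pi> H
  by (rule representation_subgroup.intro[OF finite_representation_axioms])
    (simp add: representation_subgroup_axioms_def H_subgroup)

text \<open>Comparing the two products gives an element of \<open>N \<inter> M\<close>, which is
  trivial; so the \<open>M\<close>-component of an element of \<open>P\<close> is well
  defined.\<close>

lemma NM_unique:
  assumes "n \<in> N" "m \<in> M" "n' \<in> N" "m' \<in> M" "n \<otimes>\<^bsub>G\<^esub> m = n' \<otimes>\<^bsub>G\<^esub> m'"
  shows "m = m'"
proof -
  have "inv\<^bsub>G\<^esub> n' \<otimes>\<^bsub>G\<^esub> n = m' \<otimes>\<^bsub>G\<^esub> inv\<^bsub>G\<^esub> m"
  proof -
    have "inv\<^bsub>G\<^esub> n' \<otimes>\<^bsub>G\<^esub> (n \<otimes>\<^bsub>G\<^esub> m) \<otimes>\<^bsub>G\<^esub> inv\<^bsub>G\<^esub> m = inv\<^bsub>G\<^esub> n' \<otimes>\<^bsub>G\<^esub> n"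
      using assms(1-4) by (simp add: G.m_assoc)
    moreover have "inv\<^bsub>G\<^esub> n' \<otimes>\<^bsub>G\<^esub> (n' \<otimes>\<^bsub>G\<^esub> m') \<otimes>\<^bsub>G\<^esub> inv\<^bsub>G\<^esub> m = m' \<otimes>\<^bsub>G\<^esub> inv\<^bsub>G\<^esub> m"
      using assms(1-4) by (simp add: G.inv_cancel_left G.m_assoc)
    ultimately show ?thesis using assms(5) by simp
  qed
  moreover have "inv\<^bsub>G\<^esub> n' \<otimes>\<^bsub>G\<^esub> n \<in> N" "m' \<otimes>\<^bsub>G\<^esub> inv\<^bsub>G\<^esub> m \<in> M" using assms(1-4) by auto
  ultimately have "m' \<otimes>\<^bsub>G\<^esub> inv\<^bsub>G\<^esub> m \<in> N \<inter> M" by simp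
  then have "m' \<otimes>\<^bsub>G\<^esub> inv\<^bsub>G\<^esub> m = \<one>\<^bsub>G\<^esub>"
    using PNM by (simp add: semidirect_product_def del: Int_iff)
  from G.inv_equality[OF this] show ?thesis using assms(2,4) by simp
qed

text \<open>Here the decomposition of \<open>P \<inter> K\<close> enters: both factors can be taken
  in \<open>K\<close>. With \<open>NM_unique\<close>, the \<open>M\<close>-component of an element
  of \<open>P \<inter> K\<close> lies in \<open>K\<close>.\<close>

lemma PK_decomp:
  assumes "p \<in> P" "p \<in> K"
  obtains n m where "n \<in> N" "n \<in> K" "m \<in> M" "m \<in> K" "p = n \<otimes>\<^bsub>G\<^esub> m"
proof -
  have "p \<in> (N \<inter> K) <#>\<^bsub>G\<^esub> (M \<inter> K)"
    using assms PNM_K by (simp add: semidirect_product_def)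
  then show ?thesis using that by (auto simp: set_mult_def)
qed

section \<open>Bijections between families of cosets of \<open>N \<inter> K\<close> in
  \<open>N\<close>\<close>

lemma lcosets_N: "lcosets\<^bsub>G\<lparr>carrier := N\<rparr>\<^esub> H = (\<lambda>n. n <#\<^bsub>G\<^esub> H) ` N"
  by (auto simp: LCOSETS_def l_coset_def)

lemma rcosets_N: "rcosets\<^bsub>G\<lparr>carrier := N\<rparr>\<^esub> H = (\<lambda>n. H #>\<^bsub>G\<^esub> n) ` N"
  by (auto simp: RCOSETS_def r_coset_def)

lemma l_coset_N: "n \<in> N \<Longrightarrow> n <#\<^bsub>G\<^esub> H \<subseteq> N"
  by (auto simp: l_coset_def)

lemma r_coset_N: "n \<in> N \<Longrightarrow> H #>\<^bsub>G\<^esub> n \<subseteq> N"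
  by (auto simp: r_coset_def)

lemma lcosets_translate:
  assumes a: "a \<in> N"
  shows "inj_on ((`) (\<lambda>n. a \<otimes>\<^bsub>G\<^esub> n)) ((\<lambda>n. n <#\<^bsub>G\<^esub> H) ` N)"
    "(`) (\<lambda>n. a \<otimes>\<^bsub>G\<^esub> n) ` (\<lambda>n. n <#\<^bsub>G\<^esub> H) ` N = (\<lambda>n. n <#\<^bsub>G\<^esub> H) ` N"
proof -
  have "bij_betw (\<lambda>n. a \<otimes>\<^bsub>G\<^esub> n) N N"
    by (rule bij_betw_byWitness[where f' = "\<lambda>n. inv\<^bsub>G\<^esub> a \<otimes>\<^bsub>G\<^esub> n"])
       (use a in \<open>auto simp: G.inv_cancel_left\<close>)
  moreover have "(\<lambda>n. a \<otimes>\<^bsub>G\<^esub> n) ` (n <#\<^bsub>G\<^esub> H) = (a \<otimes>\<^bsub>G\<^esub> n) <#\<^bsub>G\<^esub> H" if "n \<in> N" for n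
    using a that by (auto simp: l_coset_def G.m_assoc image_iff)
  ultimately show "inj_on ((`) (\<lambda>n. a \<otimes>\<^bsub>G\<^esub> n)) ((\<lambda>n. n <#\<^bsub>G\<^esub> H) ` N)"
    "(`) (\<lambda>n. a \<otimes>\<^bsub>G\<^esub> n) ` (\<lambda>n. n <#\<^bsub>G\<^esub> H) ` N = (\<lambda>n. n <#\<^bsub>G\<^esub> H) ` N"
    using coset_family_transform[of "\<lambda>n. a \<otimes>\<^bsub>G\<^esub> n" N "\<lambda>n. n <#\<^bsub>G\<^esub> H" "\<lambda>n. n <#\<^bsub>G\<^esub> H"] l_coset_N
    by blast+
qed

text \<open>An element of \<open>M \<inter> K\<close> normalizes \<open>N\<close>, because it lies
  in \<open>P\<close>, and normalizes \<open>K\<close>, because it lies in \<open>K\<close>; hence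
  it normalizes \<open>H\<close>, and conjugation permutes the cosets. This is the change of
  variable behind \<open>satake_equivariant\<close>.\<close>

lemma lcosets_conj:
  assumes y: "y \<in> M" "y \<in> K"
  defines "\<theta> \<equiv> \<lambda>n. y \<otimes>\<^bsub>G\<^esub> n \<otimes>\<^bsub>G\<^esub> inv\<^bsub>G\<^esub> y"
  shows "inj_on ((`) \<theta>) ((\<lambda>n. n <#\<^bsub>G\<^esub> H) ` N)"
    "(`) \<theta> ` (\<lambda>n. n <#\<^bsub>G\<^esub> H) ` N = (\<lambda>n. n <#\<^bsub>G\<^esub> H) ` N"
proof -
  have yP: "y \<in> P" using y NM_subset by blast
  have yG: "y \<in> carrier G" using y by simp
  have \<theta>\<theta>: "inv\<^bsub>G\<^esub> y \<otimes>\<^bsub>G\<^esub> \<theta> n \<otimes>\<^bsub>G\<^esub> y = n" "\<theta> (inv\<^bsub>G\<^esub> y \<otimes>\<^bsub>G\<^esub> n \<otimes>\<^bsub>G\<^esub> y) = n"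
    if "n \<in> carrier G" for n
    using that yG by (simp_all add: \<theta>_def G.m_assoc G.inv_cancel_left)
  have \<theta>_mult: "\<theta> (n \<otimes>\<^bsub>G\<^esub> n') = \<theta> n \<otimes>\<^bsub>G\<^esub> \<theta> n'" if "n \<in> carrier G" "n' \<in> carrier G" for n n'
    using that yG by (simp add: \<theta>_def G.m_assoc G.inv_cancel_left)
  have "bij_betw \<theta> N N"
    by (rule bij_betw_byWitness[where f' = "\<lambda>n. inv\<^bsub>G\<^esub> y \<otimes>\<^bsub>G\<^esub> n \<otimes>\<^bsub>G\<^esub> y"])
       (use N_conj[OF yP] \<theta>\<theta> in \<open>auto simp: \<theta>_def\<close>)
  moreover have \<theta>H: "\<theta> ` H = H"
  proof
    show "\<theta> ` H \<subseteq> H" using N_conj(1)[OF yP] y by (auto simp: \<theta>_def)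
    show "H \<subseteq> \<theta> ` H"
    proof
      fix h assume h: "h \<in> H"
      then have "inv\<^bsub>G\<^esub> y \<otimes>\<^bsub>G\<^esub> h \<otimes>\<^bsub>G\<^esub> y \<in> H" using N_conj(2)[OF yP] y by auto
      then have "\<theta> (inv\<^bsub>G\<^esub> y \<otimes>\<^bsub>G\<^esub> h \<otimes>\<^bsub>G\<^esub> y) \<in> \<theta> ` H" by (rule imageI)
      then show "h \<in> \<theta> ` H" using \<theta>\<theta>(2)[of h] h by simp
    qed
  qed
  moreover have "\<theta> ` (n <#\<^bsub>G\<^esub> H) = \<theta> n <#\<^bsub>G\<^esub> H" if n: "n \<in> N" for n
  proof -
    have "\<theta> ` (n <#\<^bsub>G\<^esub> H) = (\<lambda>h. \<theta> (n \<otimes>\<^bsub>G\<^esub> h)) ` H" by (auto simp: l_coset_def image_iff)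
    also have "\<dots> = (\<lambda>h. \<theta> n \<otimes>\<^bsub>G\<^esub> h) ` \<theta> ` H"
      unfolding image_image using n by (intro image_cong) (auto simp: \<theta>_mult)
    also have "\<dots> = \<theta> n <#\<^bsub>G\<^esub> H" unfolding \<theta>H by (auto simp: l_coset_def)
    finally show ?thesis .
  qed
  ultimately show "inj_on ((`) \<theta>) ((\<lambda>n. n <#\<^bsub>G\<^esub> H) ` N)"
    "(`) \<theta> ` (\<lambda>n. n <#\<^bsub>G\<^esub> H) ` N = (\<lambda>n. n <#\<^bsub>G\<^esub> H) ` N"
    using coset_family_transform[of \<theta> N "\<lambda>n. n <#\<^bsub>G\<^esub> H" "\<lambda>n. n <#\<^bsub>G\<^esub> H"] l_coset_N
    by blast+
qed

lemma rcosets_inverse: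
  shows "inj_on ((`) (\<lambda>n. inv\<^bsub>G\<^esub> n)) ((\<lambda>n. H #>\<^bsub>G\<^esub> n) ` N)"
    "(`) (\<lambda>n. inv\<^bsub>G\<^esub> n) ` (\<lambda>n. H #>\<^bsub>G\<^esub> n) ` N = (\<lambda>n. n <#\<^bsub>G\<^esub> H) ` N"
proof -
  have "bij_betw (\<lambda>n. inv\<^bsub>G\<^esub> n) N N"
    by (rule bij_betw_byWitness[where f' = "\<lambda>n. inv\<^bsub>G\<^esub> n"]) auto
  moreover have "(\<lambda>n. inv\<^bsub>G\<^esub> n) ` (H #>\<^bsub>G\<^esub> n) = inv\<^bsub>G\<^esub> n <#\<^bsub>G\<^esub> H" if n: "n \<in> N" for n
  proof
    show "(\<lambda>n. inv\<^bsub>G\<^esub> n) ` (H #>\<^bsub>G\<^esub> n) \<subseteq> inv\<^bsub>G\<^esub> n <#\<^bsub>G\<^esub> H"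
      using n by (auto simp: r_coset_def l_coset_def G.inv_mult_group)
    show "inv\<^bsub>G\<^esub> n <#\<^bsub>G\<^esub> H \<subseteq> (\<lambda>n. inv\<^bsub>G\<^esub> n) ` (H #>\<^bsub>G\<^esub> n)"
    proof
      fix x assume "x \<in> inv\<^bsub>G\<^esub> n <#\<^bsub>G\<^esub> H"
      then obtain h where h: "h \<in> H" "x = inv\<^bsub>G\<^esub> n \<otimes>\<^bsub>G\<^esub> h" by (auto simp: l_coset_def)
      then have "x = inv\<^bsub>G\<^esub> (inv\<^bsub>G\<^esub> h \<otimes>\<^bsub>G\<^esub> n)" using n by (auto simp: G.inv_mult_group)
      moreover have "inv\<^bsub>G\<^esub> h \<otimes>\<^bsub>G\<^esub> n \<in> H #>\<^bsub>G\<^esub> n" using h by (auto simp: r_coset_def)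
      ultimately show "x \<in> (\<lambda>n. inv\<^bsub>G\<^esub> n) ` (H #>\<^bsub>G\<^esub> n)" by blast
    qed
  qed
  ultimately show "inj_on ((`) (\<lambda>n. inv\<^bsub>G\<^esub> n)) ((\<lambda>n. H #>\<^bsub>G\<^esub> n) ` N)"
    "(`) (\<lambda>n. inv\<^bsub>G\<^esub> n) ` (\<lambda>n. H #>\<^bsub>G\<^esub> n) ` N = (\<lambda>n. n <#\<^bsub>G\<^esub> H) ` N"
    using coset_family_transform[of "\<lambda>n. inv\<^bsub>G\<^esub> n" N "\<lambda>n. H #>\<^bsub>G\<^esub> n" "\<lambda>n. n <#\<^bsub>G\<^esub> H"] r_coset_N
    by blast+
qed

abbreviation "X \<equiv> (\<lambda>n. n <#\<^bsub>G\<^esub> H) ` N"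

lemma D_additive: "additive_module D"
  by (rule additive_module.intro[OF D.abelian_monoid_axioms])

lemma Q_additive: "additive_module Q"
  by (rule additive_module.intro[OF Q_abelian_monoid])

text \<open>Two elements of \<open>N\<close> that agree modulo \<open>K\<close> already agree modulo
  \<open>N \<inter> K\<close>: the injectivity behind the finiteness of the Satake sum.\<close>

lemma l_coset_H_eqI:
  assumes "n \<in> N" "n' \<in> N" "inv\<^bsub>G\<^esub> n \<otimes>\<^bsub>G\<^esub> n' \<in> K"
  shows "n <#\<^bsub>G\<^esub> H = n' <#\<^bsub>G\<^esub> H"
proof (rule G.l_repr_independence[OF _ _ H_subgroup])
  have "n' = n \<otimes>\<^bsub>G\<^esub> (inv\<^bsub>G\<^esub> n \<otimes>\<^bsub>G\<^esub> n')" using assms(1,2) by (simp add: G.inv_cancel_left)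
  moreover have "inv\<^bsub>G\<^esub> n \<otimes>\<^bsub>G\<^esub> n' \<in> H" using assms by simp
  ultimately show "n' \<in> n <#\<^bsub>G\<^esub> H" unfolding l_coset_def by blast
qed (use assms in simp)

text \<open>\<open>M \<inter> K\<close> normalizes \<open>H\<close>, so its action preserves
  \<open>H\<close>-invariants. Without this, equivariance of the Satake transform could not even be
  stated on \<open>F\<close>.\<close>

lemma \<rho>_F_closed:
  assumes y: "y \<in> M" "y \<in> K" and l: "l \<in> carrier F"
  shows "\<rho> y l \<in> carrier F"
  unfolding F_iff
proof (intro conjI ballI)
  show "\<rho> y l \<in> carrier D" using y F_D[OF l] by simp
  fix h v assume h: "h \<in> H" and v: "v \<in> carrier V"
  have yP: "y \<in> P" using y NM_subset by blast
  have h': "inv\<^bsub>G\<^esub> y \<otimes>\<^bsub>G\<^esub> h \<otimes>\<^bsub>G\<^esub> y \<in> H" using N_conj(2)[OF yP, of h] h y by simp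
  have eq: "inv\<^bsub>G\<^esub> y \<otimes>\<^bsub>G\<^esub> h = (inv\<^bsub>G\<^esub> y \<otimes>\<^bsub>G\<^esub> h \<otimes>\<^bsub>G\<^esub> y) \<otimes>\<^bsub>G\<^esub> inv\<^bsub>G\<^esub> y"
    using h y by (simp add: G.m_assoc)
  have "\<rho> y l (\<pi> h v) = l (\<pi> (inv\<^bsub>G\<^esub> y \<otimes>\<^bsub>G\<^esub> h) v)"
    using h v y F_D[OF l] by (simp add: \<rho>_apply \<pi>_mult)
  also have "\<dots> = l (\<pi> (inv\<^bsub>G\<^esub> y \<otimes>\<^bsub>G\<^esub> h \<otimes>\<^bsub>G\<^esub> y) (\<pi> (inv\<^bsub>G\<^esub> y) v))"
    by (subst eq, subst \<pi>_mult) (use h h' v y in auto)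
  also have "\<dots> = l (\<pi> (inv\<^bsub>G\<^esub> y) v)"
    using l h' v y by (simp add: F_iff)
  also have "\<dots> = \<rho> y l v" using v F_D[OF l] by (simp add: \<rho>_apply)
  finally show "\<rho> y l (\<pi> h v) = \<rho> y l v" .
qed

lemma \<rho>_coset_sum:
  assumes x: "x \<in> K" and f: "coset_summable D f Y"
  shows "\<rho> x (coset_sum D f Y) = coset_sum D (\<lambda>n. \<rho> x (f n)) Y"
    "coset_summable D (\<lambda>n. \<rho> x (f n)) Y"
proof -
  have "\<rho> x \<zero>\<^bsub>D\<^esub> = \<zero>\<^bsub>D\<^esub>"
    by (rule dual_ext) (use x in \<open>auto simp: \<rho>_apply dual_apply\<close>)
  moreover have "\<rho> x \<in> carrier D \<rightarrow> carrier D" using x by simp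
  moreover note lin_mapsD(3)[OF \<rho>_lin[OF x]]
  ultimately have "\<rho> x (coset_sum D f Y) = coset_sum D (\<rho> x \<circ> f) Y" "coset_summable D (\<rho> x \<circ> f) Y"
    using additive_module.coset_sum_hom[OF D_additive D.abelian_monoid_axioms _ _ _ f] by blast+
  then show "\<rho> x (coset_sum D f Y) = coset_sum D (\<lambda>n. \<rho> x (f n)) Y"
    "coset_summable D (\<lambda>n. \<rho> x (f n)) Y" by (simp_all add: comp_def)
qed

text \<open>Moves a sum of functionals to a sum of scalars, the common ground on which it can be
  compared with a sum of coinvariant classes.\<close>

lemma coset_sum_scalar:
  assumes "coset_summable D f Z" "v \<in> carrier V"
  shows "coset_sum D f Z v = coset_sum (scalar_module C) (\<lambda>n. f n v) Z"
    "coset_summable (scalar_module C) (\<lambda>n. f n v) Z"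
proof -
  have "(\<lambda>l. l v) (coset_sum D f Z) = coset_sum (scalar_module C) ((\<lambda>l. l v) \<circ> f) Z"
    "coset_summable (scalar_module C) ((\<lambda>l. l v) \<circ> f) Z"
    using additive_module.coset_sum_hom[OF D_additive scalar_module_abelian_monoid _ _ _ assms(1),
        of "\<lambda>l. l v"] assms(2)
    by (simp_all add: dual_apply dualD(2))
  then show "coset_sum D f Z v = coset_sum (scalar_module C) (\<lambda>n. f n v) Z"
    "coset_summable (scalar_module C) (\<lambda>n. f n v) Z" by (simp_all add: comp_def)
qed

text \<open>If \<open>mn\<close> and \<open>m'n'\<close> lie in the same coset \<open>Kj\<close>, then \<open>m'n'(mn)\<^sup>-\<^sup>1\<close> lies in \<open>P \<inter> K\<close> and
  its \<open>M\<close>-component is \<open>m'm\<^sup>-\<^sup>1\<close>; hence each \<open>Kj\<close> contributes at most one coset of \<open>M \<inter> K\<close>.\<close>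

lemma M_component_K:
  assumes m: "m \<in> M" "m' \<in> M" and n: "n \<in> N" "n' \<in> N" and j: "j \<in> carrier G"
    and mn: "m \<otimes>\<^bsub>G\<^esub> n \<in> K #>\<^bsub>G\<^esub> j" "m' \<otimes>\<^bsub>G\<^esub> n' \<in> K #>\<^bsub>G\<^esub> j"
  shows "m' \<otimes>\<^bsub>G\<^esub> inv\<^bsub>G\<^esub> m \<in> K"
proof -
  obtain k k' where k: "k \<in> K" "k' \<in> K" "m \<otimes>\<^bsub>G\<^esub> n = k \<otimes>\<^bsub>G\<^esub> j" "m' \<otimes>\<^bsub>G\<^esub> n' = k' \<otimes>\<^bsub>G\<^esub> j"
    using mn by (auto simp: r_coset_def)
  let ?p = "(m' \<otimes>\<^bsub>G\<^esub> n') \<otimes>\<^bsub>G\<^esub> inv\<^bsub>G\<^esub> (m \<otimes>\<^bsub>G\<^esub> n)"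
  have "?p = k' \<otimes>\<^bsub>G\<^esub> inv\<^bsub>G\<^esub> k"
    unfolding k(3,4) using k(1,2) j by (simp add: G.inv_mult_group G.m_assoc G.inv_cancel_left)
  then have pK: "?p \<in> K" using k(1,2) by simp
  have mP: "m' \<in> P" using m NM_subset by blast
  \<comment> \<open>Moving the \<open>N\<close>-part to the left past \<open>m'\<close> conjugates
    it by \<open>m'\<close>, which keeps it in \<open>N\<close> by normality. This writes
    \<open>?p\<close> as \<open>a\<close> times the product of \<open>m'\<close> with the inverse of
    \<open>m\<close>, exposing its \<open>M\<close>-component.\<close>
  define a where "a = m' \<otimes>\<^bsub>G\<^esub> (n' \<otimes>\<^bsub>G\<^esub> inv\<^bsub>G\<^esub> n) \<otimes>\<^bsub>G\<^esub> inv\<^bsub>G\<^esub> m'"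
  have a: "a \<in> N" unfolding a_def using N_conj(1)[OF mP, of "n' \<otimes>\<^bsub>G\<^esub> inv\<^bsub>G\<^esub> n"] n by simp
  have p: "?p = a \<otimes>\<^bsub>G\<^esub> (m' \<otimes>\<^bsub>G\<^esub> inv\<^bsub>G\<^esub> m)"
    unfolding a_def using m n by (simp add: G.inv_mult_group G.m_assoc G.inv_cancel_left)
  have "a \<in> P" "m' \<otimes>\<^bsub>G\<^esub> inv\<^bsub>G\<^esub> m \<in> P" using a m NM_subset by auto
  then have "?p \<in> P" unfolding p by (rule subgroup.m_closed[OF P])
  from PK_decomp[OF this pK] obtain b c where
    bc: "b \<in> N" "b \<in> K" "c \<in> M" "c \<in> K" "?p = b \<otimes>\<^bsub>G\<^esub> c" .
  have "m' \<otimes>\<^bsub>G\<^esub> inv\<^bsub>G\<^esub> m = c"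
    by (rule NM_unique[OF a _ bc(1,3)]) (use m p bc(5) in auto)
  then show ?thesis using bc(4) by simp
qed

section \<open>The Satake transform on invariant functionals\<close>

context
  fixes \<Phi>
  assumes \<Phi>: "\<Phi> \<in> carrier (hecke_dual C G K V \<pi>)"
begin

abbreviation "S \<equiv> satake C G K M N V \<pi> \<Phi>"

lemma support_left:
  obtains J where "finite J" "J \<subseteq> carrier G"
    "\<And>g. g \<in> carrier G \<Longrightarrow> \<Phi> g \<noteq> (\<lambda>l\<in>carrier D. \<zero>\<^bsub>D\<^esub>) \<Longrightarrow> \<exists>j\<in>J. g \<in> j <#\<^bsub>G\<^esub> K"
proof -
  obtain F where F: "finite F" "F \<subseteq> carrier G"
    "{g \<in> carrier G. \<Phi> g \<noteq> (\<lambda>l\<in>carrier D. \<zero>\<^bsub>D\<^esub>)} = (\<Union>g\<in>F. double_coset G K g)"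
    using hecke_dualD(4)[OF \<Phi>] by blast
  have "\<forall>g\<in>F. \<exists>J. finite J \<and> J \<subseteq> carrier G \<and> double_coset G K g = (\<Union>j\<in>J. j <#\<^bsub>G\<^esub> K)"
    using finite_left F(2) by blast
  from bchoice[OF this] obtain J where J: "\<forall>g\<in>F. finite (J g) \<and> J g \<subseteq> carrier G \<and>
      double_coset G K g = (\<Union>j\<in>J g. j <#\<^bsub>G\<^esub> K)" ..
  show thesis
  proof (rule that[of "\<Union>(J ` F)"])
    show "finite (\<Union>(J ` F))" using J F(1) by (intro finite_UN_I) simp_all
    show "\<Union>(J ` F) \<subseteq> carrier G" using J by (intro UN_least) simp
    fix g assume "g \<in> carrier G" "\<Phi> g \<noteq> (\<lambda>l\<in>carrier D. \<zero>\<^bsub>D\<^esub>)"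
    then obtain f where "f \<in> F" "g \<in> double_coset G K f" using F(3) by blast
    then have "g \<in> (\<Union>j\<in>J f. j <#\<^bsub>G\<^esub> K)" using J by simp
    then show "\<exists>j\<in>\<Union>(J ` F). g \<in> j <#\<^bsub>G\<^esub> K" using \<open>f \<in> F\<close> by blast
  qed
qed

lemma support_right:
  obtains J where "finite J" "J \<subseteq> carrier G"
    "\<And>g. g \<in> carrier G \<Longrightarrow> \<Phi> g \<noteq> (\<lambda>l\<in>carrier D. \<zero>\<^bsub>D\<^esub>) \<Longrightarrow> \<exists>j\<in>J. g \<in> K #>\<^bsub>G\<^esub> j"
proof -
  obtain F where F: "finite F" "F \<subseteq> carrier G"
    "{g \<in> carrier G. \<Phi> g \<noteq> (\<lambda>l\<in>carrier D. \<zero>\<^bsub>D\<^esub>)} = (\<Union>g\<in>F. double_coset G K g)"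
    using hecke_dualD(4)[OF \<Phi>] by blast
  have "\<forall>g\<in>F. \<exists>J. finite J \<and> J \<subseteq> carrier G \<and> double_coset G K g = (\<Union>j\<in>J. K #>\<^bsub>G\<^esub> j)"
    using finite_right F(2) by blast
  from bchoice[OF this] obtain J where J: "\<forall>g\<in>F. finite (J g) \<and> J g \<subseteq> carrier G \<and>
      double_coset G K g = (\<Union>j\<in>J g. K #>\<^bsub>G\<^esub> j)" ..
  show thesis
  proof (rule that[of "\<Union>(J ` F)"])
    show "finite (\<Union>(J ` F))" using J F(1) by (intro finite_UN_I) simp_all
    show "\<Union>(J ` F) \<subseteq> carrier G" using J by (intro UN_least) simp
    fix g assume "g \<in> carrier G" "\<Phi> g \<noteq> (\<lambda>l\<in>carrier D. \<zero>\<^bsub>D\<^esub>)"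
    then obtain f where "f \<in> F" "g \<in> double_coset G K f" using F(3) by blast
    then have "g \<in> (\<Union>j\<in>J f. K #>\<^bsub>G\<^esub> j)" using J by simp
    then show "\<exists>j\<in>\<Union>(J ` F). g \<in> K #>\<^bsub>G\<^esub> j" using \<open>f \<in> F\<close> by blast
  qed
qed

text \<open>The map \<open>nH \<mapsto> mnK\<close> is injective, so only finitely many cosets \<open>nH\<close> contribute.\<close>

lemma finite_support_cosets:
  assumes m: "m \<in> carrier G"
  shows "finite {c \<in> X. \<exists>n\<in>c. \<Phi> (m \<otimes>\<^bsub>G\<^esub> n) \<noteq> (\<lambda>l\<in>carrier D. \<zero>\<^bsub>D\<^esub>)}"
proof -
  obtain J where J: "finite J" "J \<subseteq> carrier G"
    "\<And>g. g \<in> carrier G \<Longrightarrow> \<Phi> g \<noteq> (\<lambda>l\<in>carrier D. \<zero>\<^bsub>D\<^esub>) \<Longrightarrow> \<exists>j\<in>J. g \<in> j <#\<^bsub>G\<^esub> K"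
    using support_left by blast
  define Y where "Y j = {c \<in> X. \<exists>n\<in>c. m \<otimes>\<^bsub>G\<^esub> n \<in> j <#\<^bsub>G\<^esub> K}" for j
  have Y_unique: "c = c'" if c: "c \<in> Y j" "c' \<in> Y j" and j: "j \<in> J" for c c' j
  proof -
    have *: "\<exists>n\<in>N. c = n <#\<^bsub>G\<^esub> H \<and> m \<otimes>\<^bsub>G\<^esub> n \<in> j <#\<^bsub>G\<^esub> K" if "c \<in> Y j" for c
    proof -
      obtain n n' where n: "n' \<in> N" "c = n' <#\<^bsub>G\<^esub> H" "n \<in> c" "m \<otimes>\<^bsub>G\<^esub> n \<in> j <#\<^bsub>G\<^esub> K"
        using \<open>c \<in> Y j\<close> unfolding Y_def by blast
      then have "n \<in> N" using l_coset_N by blast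
      moreover have "c = n <#\<^bsub>G\<^esub> H"
        using G.l_repr_independence[OF _ _ H_subgroup, of n n'] n by simp
      ultimately show ?thesis using n(4) by blast
    qed
    from *[OF c(1)] *[OF c(2)] obtain n n' where n:
      "n \<in> N" "c = n <#\<^bsub>G\<^esub> H" "m \<otimes>\<^bsub>G\<^esub> n \<in> j <#\<^bsub>G\<^esub> K"
      "n' \<in> N" "c' = n' <#\<^bsub>G\<^esub> H" "m \<otimes>\<^bsub>G\<^esub> n' \<in> j <#\<^bsub>G\<^esub> K" by (elim bexE conjE)
    then obtain k k' where k: "k \<in> K" "k' \<in> K" "m \<otimes>\<^bsub>G\<^esub> n = j \<otimes>\<^bsub>G\<^esub> k" "m \<otimes>\<^bsub>G\<^esub> n' = j \<otimes>\<^bsub>G\<^esub> k'"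
      by (auto simp: l_coset_def)
    have jG: "j \<in> carrier G" using j J(2) by blast
    \<comment> \<open>The factor \<open>m\<close> cancels on one side and \<open>j\<close> on the
      other, leaving an element of \<open>K\<close>.\<close>
    have "inv\<^bsub>G\<^esub> n \<otimes>\<^bsub>G\<^esub> n' = inv\<^bsub>G\<^esub> (m \<otimes>\<^bsub>G\<^esub> n) \<otimes>\<^bsub>G\<^esub> (m \<otimes>\<^bsub>G\<^esub> n')"
      using m n(1,4) by (simp add: G.inv_mult_group G.m_assoc G.inv_cancel_left)
    also have "\<dots> = inv\<^bsub>G\<^esub> k \<otimes>\<^bsub>G\<^esub> k'"
      unfolding k(3,4) using jG k(1,2) by (simp add: G.inv_mult_group G.m_assoc G.inv_cancel_left)
    finally have "inv\<^bsub>G\<^esub> n \<otimes>\<^bsub>G\<^esub> n' \<in> K" using k(1,2) by simp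
    then show ?thesis using l_coset_H_eqI[OF n(1,4)] n(2,5) by simp
  qed
  have "finite (Y j)" if "j \<in> J" for j
  proof (cases "Y j = {}")
    case False
    then obtain c0 where "c0 \<in> Y j" by blast
    then have "Y j \<subseteq> {c0}" using Y_unique that by blast
    then show ?thesis by (rule finite_subset) simp
  qed simp
  then have fin: "finite (\<Union>j\<in>J. Y j)" using J(1) by simp
  show ?thesis
  proof (rule finite_subset[OF _ fin], rule subsetI)
    fix c assume c: "c \<in> {c \<in> X. \<exists>n\<in>c. \<Phi> (m \<otimes>\<^bsub>G\<^esub> n) \<noteq> (\<lambda>l\<in>carrier D. \<zero>\<^bsub>D\<^esub>)}"
    then obtain n where n: "n \<in> c" "\<Phi> (m \<otimes>\<^bsub>G\<^esub> n) \<noteq> (\<lambda>l\<in>carrier D. \<zero>\<^bsub>D\<^esub>)" by blast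
    have "n \<in> N" using c n(1) l_coset_N by blast
    then have "\<exists>j\<in>J. m \<otimes>\<^bsub>G\<^esub> n \<in> j <#\<^bsub>G\<^esub> K" using J(3)[OF _ n(2)] m by simp
    moreover have "c \<in> X" using c by simp
    ultimately show "c \<in> (\<Union>j\<in>J. Y j)" using n(1) unfolding Y_def by blast
  qed
qed

text \<open>Equivariance moves \<open>h\<close> onto \<open>l\<close>, which is fixed by
  \<open>H\<close>; this makes the sum over \<open>N/(N \<inter> K)\<close> meaningful.\<close>

lemma satake_summand_invariant:
  assumes "m \<in> carrier G" "l \<in> carrier F" "n \<in> N" "h \<in> H"
  shows "\<Phi> (m \<otimes>\<^bsub>G\<^esub> (n \<otimes>\<^bsub>G\<^esub> h)) l = \<Phi> (m \<otimes>\<^bsub>G\<^esub> n) l"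
proof -
  have "\<rho> \<one>\<^bsub>G\<^esub> l' = l'" if "l' \<in> carrier D" for l'
    by (rule dual_ext) (use that in \<open>auto simp: \<rho>_apply \<pi>_one\<close>)
  moreover have "\<rho> h l = l" using assms(2,4) by (simp add: fixed_vectors_def)
  moreover have "m \<otimes>\<^bsub>G\<^esub> (n \<otimes>\<^bsub>G\<^esub> h) = \<one>\<^bsub>G\<^esub> \<otimes>\<^bsub>G\<^esub> (m \<otimes>\<^bsub>G\<^esub> n) \<otimes>\<^bsub>G\<^esub> h"
    using assms by (simp add: G.m_assoc)
  ultimately show ?thesis
    using assms \<Phi>_equivariant[OF \<Phi>, of "\<one>\<^bsub>G\<^esub>" "m \<otimes>\<^bsub>G\<^esub> n" h l] F_D[OF assms(2)] \<Phi>_closed[OF \<Phi>]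
    by simp
qed

lemma satake_summable:
  assumes "m \<in> carrier G" "l \<in> carrier F"
  shows "coset_summable D (\<lambda>n. \<Phi> (m \<otimes>\<^bsub>G\<^esub> n) l) X"
  unfolding coset_summable_def
proof
  have im: "(\<lambda>n. \<Phi> (m \<otimes>\<^bsub>G\<^esub> n) l) ` (n <#\<^bsub>G\<^esub> H) = {\<Phi> (m \<otimes>\<^bsub>G\<^esub> n) l}" if n: "n \<in> N" for n
  proof -
    have "n \<in> n <#\<^bsub>G\<^esub> H" using G.lcos_self[OF _ H_subgroup] n by simp
    moreover have "(\<lambda>n. \<Phi> (m \<otimes>\<^bsub>G\<^esub> n) l) ` (n <#\<^bsub>G\<^esub> H) = (\<lambda>_. \<Phi> (m \<otimes>\<^bsub>G\<^esub> n) l) ` (n <#\<^bsub>G\<^esub> H)"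
      using satake_summand_invariant[OF assms n] by (intro image_cong) (auto simp: l_coset_def)
    ultimately show ?thesis by (simp add: image_constant)
  qed
  then show "\<forall>c\<in>X. \<exists>w\<in>carrier D. (\<lambda>n. \<Phi> (m \<otimes>\<^bsub>G\<^esub> n) l) ` c = {w}"
    using \<Phi>_closed[OF \<Phi>] F_D[OF assms(2)] assms(1) by simp
  show "finite {c \<in> X. (\<lambda>n. \<Phi> (m \<otimes>\<^bsub>G\<^esub> n) l) ` c \<noteq> {\<zero>\<^bsub>D\<^esub>}}"
  proof (rule finite_subset[OF _ finite_support_cosets[OF assms(1)]], rule subsetI)
    fix c assume c: "c \<in> {c \<in> X. (\<lambda>n. \<Phi> (m \<otimes>\<^bsub>G\<^esub> n) l) ` c \<noteq> {\<zero>\<^bsub>D\<^esub>}}"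
    then obtain n where n: "n \<in> N" "c = n <#\<^bsub>G\<^esub> H" by blast
    have "\<Phi> (m \<otimes>\<^bsub>G\<^esub> n) l \<noteq> \<zero>\<^bsub>D\<^esub>" using c im[OF n(1)] n(2) by auto
    then have "\<Phi> (m \<otimes>\<^bsub>G\<^esub> n) \<noteq> (\<lambda>l\<in>carrier D. \<zero>\<^bsub>D\<^esub>)" using F_D[OF assms(2)] by auto
    moreover have "n \<in> c" using G.lcos_self[OF _ H_subgroup] n by simp
    ultimately show "c \<in> {c \<in> X. \<exists>n\<in>c. \<Phi> (m \<otimes>\<^bsub>G\<^esub> n) \<noteq> (\<lambda>l\<in>carrier D. \<zero>\<^bsub>D\<^esub>)}"
      using c by blast
  qed
qed

lemma satake_apply:
  assumes "m \<in> M" "l \<in> carrier F"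
  shows "S m l = coset_sum D (\<lambda>n. \<Phi> (m \<otimes>\<^bsub>G\<^esub> n) l) X"
  using assms \<Phi> by (simp add: satake_def lcosets_N)

lemma satake_D_closed: "m \<in> M \<Longrightarrow> l \<in> carrier F \<Longrightarrow> S m l \<in> carrier D"
  using additive_module.coset_sum_closed[OF D_additive satake_summable] by (simp add: satake_apply)

text \<open>Acting by \<open>h\<close> replaces \<open>m n\<close> by
  \<open>h m n = m (?a n)\<close>, where \<open>?a\<close> is the conjugate of \<open>h\<close> by
  the inverse of \<open>m\<close>. It lies in \<open>N\<close> but possibly outside
  \<open>K\<close>, so the sum is permuted by a translation of all of \<open>N\<close> and its value
  is unchanged.\<close>

lemma satake_F_closed:
  assumes m: "m \<in> M" and l: "l \<in> carrier F"
  shows "S m l \<in> carrier F"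
proof -
  have "\<rho> h (S m l) = S m l" if h: "h \<in> H" for h
  proof -
    let ?f = "\<lambda>n. \<Phi> (m \<otimes>\<^bsub>G\<^esub> n) l"
    let ?a = "inv\<^bsub>G\<^esub> m \<otimes>\<^bsub>G\<^esub> h \<otimes>\<^bsub>G\<^esub> m"
    have hG: "h \<in> carrier G" "h \<in> K" using h by auto
    have a: "?a \<in> N" using N_conj(2)[of m h] m h NM_subset by blast
    note summ = satake_summable[OF M_closed(1)[OF m] l]
    have X_eq: "(`) (\<lambda>n. ?a \<otimes>\<^bsub>G\<^esub> n) ` X = X" by (rule lcosets_translate(2)[OF a])
    have summ': "coset_summable D (?f \<circ> (\<lambda>n. ?a \<otimes>\<^bsub>G\<^esub> n)) X"
      using coset_summable_reindex[OF lcosets_translate(1)[OF a], of D ?f] summ X_eq by simp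
    have "\<rho> h (S m l) = coset_sum D (\<lambda>n. \<rho> h (?f n)) X"
      using \<rho>_coset_sum(1)[OF hG(2) summ] m l by (simp add: satake_apply)
    also have "\<dots> = coset_sum D (?f \<circ> (\<lambda>n. ?a \<otimes>\<^bsub>G\<^esub> n)) X"
    proof (rule additive_module.coset_sum_cong[OF D_additive \<rho>_coset_sum(2)[OF hG(2) summ]])
      fix c n assume "c \<in> X" "n \<in> c"
      then have n: "n \<in> N" using l_coset_N by blast
      have "\<rho> \<one>\<^bsub>G\<^esub> l = l"
        by (rule dual_ext) (use F_D[OF l] in \<open>auto simp: \<rho>_apply \<pi>_one\<close>)
      then have "\<rho> h (?f n) = \<Phi> (h \<otimes>\<^bsub>G\<^esub> (m \<otimes>\<^bsub>G\<^esub> n) \<otimes>\<^bsub>G\<^esub> \<one>\<^bsub>G\<^esub>) l"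
        using \<Phi>_equivariant[OF \<Phi> hG(2), of "m \<otimes>\<^bsub>G\<^esub> n" "\<one>\<^bsub>G\<^esub>" l] m n F_D[OF l] by simp
      also have "h \<otimes>\<^bsub>G\<^esub> (m \<otimes>\<^bsub>G\<^esub> n) \<otimes>\<^bsub>G\<^esub> \<one>\<^bsub>G\<^esub> = m \<otimes>\<^bsub>G\<^esub> (?a \<otimes>\<^bsub>G\<^esub> n)"
        using m n hG by (simp add: G.m_assoc G.inv_cancel_left)
      finally show "\<rho> h (?f n) = (?f \<circ> (\<lambda>n. ?a \<otimes>\<^bsub>G\<^esub> n)) n" by simp
    qed
    also have "\<dots> = S m l"
      using additive_module.coset_sum_reindex[OF D_additive lcosets_translate(1)[OF a] summ'] m l
      by (simp add: X_eq satake_apply)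
    finally show ?thesis .
  qed
  then show ?thesis using satake_D_closed[OF m l] by (simp add: fixed_vectors_def)
qed

text \<open>Substituting the conjugate of \<open>n\<close> by \<open>y\<close> lets the trailing
  \<open>y\<close> cancel against the conjugation, turning the argument into
  \<open>x m y n\<close>.\<close>

lemma satake_equivariant:
  assumes x: "x \<in> M" "x \<in> K" and m: "m \<in> M" and y: "y \<in> M" "y \<in> K" and l: "l \<in> carrier F"
  shows "S (x \<otimes>\<^bsub>G\<^esub> m \<otimes>\<^bsub>G\<^esub> y) l = \<rho> x (S m (\<rho> y l))"
proof -
  let ?\<theta> = "\<lambda>n. y \<otimes>\<^bsub>G\<^esub> n \<otimes>\<^bsub>G\<^esub> inv\<^bsub>G\<^esub> y"
  let ?f = "\<lambda>n. \<Phi> (m \<otimes>\<^bsub>G\<^esub> n) (\<rho> y l)"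
  note yl = \<rho>_F_closed[OF y l]
  note summ = satake_summable[OF M_closed(1)[OF m] yl]
  have summ': "coset_summable D (?f \<circ> ?\<theta>) X"
    using coset_summable_reindex[OF lcosets_conj(1)[OF y], of D ?f] summ lcosets_conj(2)[OF y] by simp
  have "\<rho> x (S m (\<rho> y l)) = \<rho> x (coset_sum D ?f ((`) ?\<theta> ` X))"
    using m yl lcosets_conj(2)[OF y] by (simp add: satake_apply)
  also have "\<dots> = \<rho> x (coset_sum D (?f \<circ> ?\<theta>) X)"
    using additive_module.coset_sum_reindex[OF D_additive lcosets_conj(1)[OF y] summ'] by simp
  also have "\<dots> = coset_sum D (\<lambda>n. \<rho> x ((?f \<circ> ?\<theta>) n)) X"
    by (rule \<rho>_coset_sum(1)[OF x(2) summ'])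
  also have "\<dots> = coset_sum D (\<lambda>n. \<Phi> (x \<otimes>\<^bsub>G\<^esub> m \<otimes>\<^bsub>G\<^esub> y \<otimes>\<^bsub>G\<^esub> n) l) X"
  proof (rule additive_module.coset_sum_cong[OF D_additive \<rho>_coset_sum(2)[OF x(2) summ']])
    fix c n assume "c \<in> X" "n \<in> c"
    then have n: "n \<in> N" using l_coset_N by blast
    have "\<rho> x ((?f \<circ> ?\<theta>) n) = \<Phi> (x \<otimes>\<^bsub>G\<^esub> (m \<otimes>\<^bsub>G\<^esub> ?\<theta> n) \<otimes>\<^bsub>G\<^esub> y) l"
      using \<Phi>_equivariant[OF \<Phi> x(2) _ y(2) F_D[OF l]] m n y by simp
    also have "x \<otimes>\<^bsub>G\<^esub> (m \<otimes>\<^bsub>G\<^esub> ?\<theta> n) \<otimes>\<^bsub>G\<^esub> y = x \<otimes>\<^bsub>G\<^esub> m \<otimes>\<^bsub>G\<^esub> y \<otimes>\<^bsub>G\<^esub> n"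
      using x m n y by (simp add: G.m_assoc)
    finally show "\<rho> x ((?f \<circ> ?\<theta>) n) = \<Phi> (x \<otimes>\<^bsub>G\<^esub> m \<otimes>\<^bsub>G\<^esub> y \<otimes>\<^bsub>G\<^esub> n) l" .
  qed
  also have "\<dots> = S (x \<otimes>\<^bsub>G\<^esub> m \<otimes>\<^bsub>G\<^esub> y) l"
    using x m y l by (simp add: satake_apply)
  finally show ?thesis by simp
qed

lemma satake_ext:
  "S \<in> extensional M" "m \<in> M \<Longrightarrow> S m \<in> extensional (carrier F)"
  using \<Phi> by (simp_all add: satake_def)

lemma satake_lin:
  assumes m: "m \<in> M"
  shows "S m \<in> lin_maps C F F"
proof (rule lin_mapsI)
  show "S m \<in> extensional (carrier F)" by (rule satake_ext(2)[OF m])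
  show "S m l \<in> carrier F" if "l \<in> carrier F" for l by (rule satake_F_closed[OF m that])
next
  fix l l' assume l: "l \<in> carrier F" "l' \<in> carrier F"
  note summ = satake_summable[OF M_closed(1)[OF m] l(1)] satake_summable[OF M_closed(1)[OF m] l(2)]
    satake_summable[OF M_closed(1)[OF m] F_closed(1)[OF l]]
  have "S m (l \<oplus>\<^bsub>D\<^esub> l')
      = coset_sum D (\<lambda>n. \<Phi> (m \<otimes>\<^bsub>G\<^esub> n) l \<oplus>\<^bsub>D\<^esub> \<Phi> (m \<otimes>\<^bsub>G\<^esub> n) l') X"
    unfolding satake_apply[OF m F_closed(1)[OF l]]
  proof (rule additive_module.coset_sum_cong[OF D_additive summ(3)])
    fix c n assume "c \<in> X" "n \<in> c"
    then have "n \<in> N" using l_coset_N by blast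
    then show "\<Phi> (m \<otimes>\<^bsub>G\<^esub> n) (l \<oplus>\<^bsub>D\<^esub> l') = \<Phi> (m \<otimes>\<^bsub>G\<^esub> n) l \<oplus>\<^bsub>D\<^esub> \<Phi> (m \<otimes>\<^bsub>G\<^esub> n) l'"
      using m by (intro \<Phi>_add[OF \<Phi>] F_D l) simp
  qed
  also have "\<dots> = S m l \<oplus>\<^bsub>D\<^esub> S m l'"
    using additive_module.coset_sum_add[OF D_additive summ(1,2)] m l by (simp add: satake_apply)
  finally show "S m (l \<oplus>\<^bsub>F\<^esub> l') = S m l \<oplus>\<^bsub>F\<^esub> S m l'" by (simp add: F_simps)
next
  fix a l assume a: "a \<in> carrier C" and l: "l \<in> carrier F"
  note summ = satake_summable[OF M_closed(1)[OF m] l]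
    satake_summable[OF M_closed(1)[OF m] F_closed(2)[OF a l]]
  have "S m (a \<odot>\<^bsub>D\<^esub> l) = coset_sum D ((\<lambda>u. a \<odot>\<^bsub>D\<^esub> u) \<circ> (\<lambda>n. \<Phi> (m \<otimes>\<^bsub>G\<^esub> n) l)) X"
    unfolding satake_apply[OF m F_closed(2)[OF a l]]
  proof (rule additive_module.coset_sum_cong[OF D_additive summ(2)])
    fix c n assume "c \<in> X" "n \<in> c"
    then have "n \<in> N" using l_coset_N by blast
    then have "\<Phi> (m \<otimes>\<^bsub>G\<^esub> n) (a \<odot>\<^bsub>D\<^esub> l) = a \<odot>\<^bsub>D\<^esub> \<Phi> (m \<otimes>\<^bsub>G\<^esub> n) l"
      using m by (intro \<Phi>_smult[OF \<Phi>] F_D l a) simp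
    then show "\<Phi> (m \<otimes>\<^bsub>G\<^esub> n) (a \<odot>\<^bsub>D\<^esub> l) = ((\<lambda>u. a \<odot>\<^bsub>D\<^esub> u) \<circ> (\<lambda>n. \<Phi> (m \<otimes>\<^bsub>G\<^esub> n) l)) n"
      by simp
  qed
  also have "\<dots> = a \<odot>\<^bsub>D\<^esub> S m l"
    using additive_module.coset_sum_hom(2)[OF D_additive D.abelian_monoid_axioms _ _ _ summ(1),
        of "\<lambda>u. a \<odot>\<^bsub>D\<^esub> u"] a m l
    by (simp add: satake_apply D.smult_r_distr)
  finally show "S m (a \<odot>\<^bsub>F\<^esub> l) = a \<odot>\<^bsub>F\<^esub> S m l" by (simp add: F_simps)
qed

end

abbreviation "Y \<equiv> (\<lambda>n. H #>\<^bsub>G\<^esub> n) ` N"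

section \<open>Support of the Satake transform and comparison with the coinvariant sums\<close>

context
  fixes \<Phi>
  assumes \<Phi>: "\<Phi> \<in> carrier (hecke_dual C G K V \<pi>)"
begin

abbreviation "\<Psi> \<equiv> iota C G K V \<pi> \<Phi>"

text \<open>Links the two supports: if S(Phi) is nonzero at \<open>m\<close>, then
  \<open>m N\<close> meets the support of \<open>\<Phi>\<close>.\<close>

lemma satake_nonzero_witness:
  assumes m: "m \<in> M" and nz: "S \<Phi> m \<noteq> (\<lambda>l\<in>carrier F. \<zero>\<^bsub>D\<^esub>)"
  shows "\<exists>n\<in>N. \<Phi> (m \<otimes>\<^bsub>G\<^esub> n) \<noteq> (\<lambda>l\<in>carrier D. \<zero>\<^bsub>D\<^esub>)"
proof (rule ccontr)
  assume "\<not> ?thesis"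
  then have zero: "\<Phi> (m \<otimes>\<^bsub>G\<^esub> n) = (\<lambda>l\<in>carrier D. \<zero>\<^bsub>D\<^esub>)" if "n \<in> N" for n using that by blast
  have "S \<Phi> m = (\<lambda>l\<in>carrier F. \<zero>\<^bsub>D\<^esub>)"
  proof (rule extensionalityI[OF satake_ext(2)[OF \<Phi> m] restrict_extensional])
    fix l assume l: "l \<in> carrier F"
    have "coset_sum D (\<lambda>n. \<Phi> (m \<otimes>\<^bsub>G\<^esub> n) l) X = \<zero>\<^bsub>D\<^esub>"
    proof (rule additive_module.coset_sum_zero[OF D_additive])
      fix c assume "c \<in> X"
      then obtain n where n: "n \<in> N" "c = n <#\<^bsub>G\<^esub> H" by blast
      have "(\<lambda>n. \<Phi> (m \<otimes>\<^bsub>G\<^esub> n) l) ` c = (\<lambda>_. \<zero>\<^bsub>D\<^esub>) ` c"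
        using l_coset_N[OF n(1)] n(2) zero F_D[OF l] by (intro image_cong) auto
      moreover have "n \<in> c" using G.lcos_self[OF _ H_subgroup] n by simp
      ultimately show "(\<lambda>n. \<Phi> (m \<otimes>\<^bsub>G\<^esub> n) l) ` c = {\<zero>\<^bsub>D\<^esub>}" by (simp add: image_constant)
    qed
    then show "S \<Phi> m l = (\<lambda>l\<in>carrier F. \<zero>\<^bsub>D\<^esub>) l" using l by (simp add: satake_apply[OF \<Phi> m])
  qed
  then show False using nz by simp
qed

text \<open>Each coset K j accounts for at most one coset of \<open>M \<inter> K\<close> by
  \<open>M_component_K\<close>, so finitely many representatives cover the support. Conversely,
  equivariance fills out their full double cosets.\<close>

lemma satake_support:
  obtains B where "finite B" "B \<subseteq> M"
    "{m \<in> M. S \<Phi> m \<noteq> (\<lambda>l\<in>carrier F. \<zero>\<^bsub>D\<^esub>)} = (\<Union>m\<in>B. double_coset (G\<lparr>carrier := M\<rparr>) (M \<inter> K) m)"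
proof -
  define A where "A = {m \<in> M. S \<Phi> m \<noteq> (\<lambda>l\<in>carrier F. \<zero>\<^bsub>D\<^esub>)}"
  obtain J where J: "finite J" "J \<subseteq> carrier G"
    "\<And>g. g \<in> carrier G \<Longrightarrow> \<Phi> g \<noteq> (\<lambda>l\<in>carrier D. \<zero>\<^bsub>D\<^esub>) \<Longrightarrow> \<exists>j\<in>J. g \<in> K #>\<^bsub>G\<^esub> j"
    using support_right[OF \<Phi>] by blast
  define A' where "A' j = {m \<in> A. \<exists>n\<in>N. m \<otimes>\<^bsub>G\<^esub> n \<in> K #>\<^bsub>G\<^esub> j}" for j
  have A: "A = (\<Union>j\<in>J. A' j)"
  proof (intro equalityI subsetI)
    fix m assume m: "m \<in> A"
    then obtain n where n: "n \<in> N" "\<Phi> (m \<otimes>\<^bsub>G\<^esub> n) \<noteq> (\<lambda>l\<in>carrier D. \<zero>\<^bsub>D\<^esub>)"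
      unfolding A_def using satake_nonzero_witness by blast
    have "m \<otimes>\<^bsub>G\<^esub> n \<in> carrier G" using m n(1) by (simp add: A_def)
    then show "m \<in> (\<Union>j\<in>J. A' j)" using J(3) n m unfolding A'_def by blast
  qed (auto simp: A'_def)
  \<comment> \<open>The representative is chosen in the support itself, not merely in
    \<open>M\<close>; otherwise its double coset need not consist of support points.\<close>
  define b where "b j = (SOME m. m \<in> A' j)" for j
  define B where "B = b ` {j \<in> J. A' j \<noteq> {}}"
  have bA: "b j \<in> A' j" if "A' j \<noteq> {}" for j
    unfolding b_def using that by (simp add: some_in_eq)
  have "A = (\<Union>m\<in>B. double_coset (G\<lparr>carrier := M\<rparr>) (M \<inter> K) m)"
  proof (intro equalityI subsetI)
    fix m assume "m \<in> A"
    then obtain j where j: "j \<in> J" "m \<in> A' j" using A by blast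
    then have bj: "b j \<in> A' j" using bA by blast
    obtain n n' where n: "n \<in> N" "m \<otimes>\<^bsub>G\<^esub> n \<in> K #>\<^bsub>G\<^esub> j" "n' \<in> N" "b j \<otimes>\<^bsub>G\<^esub> n' \<in> K #>\<^bsub>G\<^esub> j"
      using j(2) bj unfolding A'_def by blast
    have M: "m \<in> M" "b j \<in> M" using j(2) bj by (simp_all add: A'_def A_def)
    have "m \<otimes>\<^bsub>G\<^esub> inv\<^bsub>G\<^esub> (b j) \<in> K"
      using M_component_K[OF M(2,1) n(3,1) _ n(4,2)] j(1) J(2) by blast
    then have k: "m \<otimes>\<^bsub>G\<^esub> inv\<^bsub>G\<^esub> (b j) \<in> M \<inter> K" using M by simp
    have "m = (m \<otimes>\<^bsub>G\<^esub> inv\<^bsub>G\<^esub> (b j)) \<otimes>\<^bsub>G\<^esub> (b j \<otimes>\<^bsub>G\<^esub> \<one>\<^bsub>G\<^esub>)"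
      using M by (simp add: G.m_assoc)
    moreover have "\<one>\<^bsub>G\<^esub> \<in> M \<inter> K" by simp
    ultimately have "m \<in> double_coset (G\<lparr>carrier := M\<rparr>) (M \<inter> K) (b j)"
      using k unfolding double_coset_iff
      by (intro bexI[of _ "m \<otimes>\<^bsub>G\<^esub> inv\<^bsub>G\<^esub> (b j)"] bexI[of _ "\<one>\<^bsub>G\<^esub>"]) simp_all
    then show "m \<in> (\<Union>m\<in>B. double_coset (G\<lparr>carrier := M\<rparr>) (M \<inter> K) m)"
      using j unfolding B_def by blast
  next
    fix m assume "m \<in> (\<Union>m\<in>B. double_coset (G\<lparr>carrier := M\<rparr>) (M \<inter> K) m)"
    then obtain j k k' where j: "A' j \<noteq> {}" and k: "k \<in> M" "k \<in> K" "k' \<in> M" "k' \<in> K"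
      and m: "m = k \<otimes>\<^bsub>G\<^esub> (b j \<otimes>\<^bsub>G\<^esub> k')"
      by (auto simp: B_def double_coset_iff)
    have bM: "b j \<in> M" and nz: "S \<Phi> (b j) \<noteq> (\<lambda>l\<in>carrier F. \<zero>\<^bsub>D\<^esub>)"
      using bA[OF j] by (simp_all add: A'_def A_def)
    have mM: "m \<in> M" using k bM m by simp
    \<comment> \<open>Solving for \<open>b j\<close> lets equivariance transfer a vanishing at
      \<open>m\<close> back to \<open>b j\<close>, where the transform is nonzero.\<close>
    have bm: "b j = inv\<^bsub>G\<^esub> k \<otimes>\<^bsub>G\<^esub> m \<otimes>\<^bsub>G\<^esub> inv\<^bsub>G\<^esub> k'"
      using k bM m by (simp add: G.m_assoc G.inv_cancel_left)
    have "S \<Phi> m \<noteq> (\<lambda>l\<in>carrier F. \<zero>\<^bsub>D\<^esub>)"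
    proof
      assume Sm: "S \<Phi> m = (\<lambda>l\<in>carrier F. \<zero>\<^bsub>D\<^esub>)"
      have "S \<Phi> (b j) = (\<lambda>l\<in>carrier F. \<zero>\<^bsub>D\<^esub>)"
      proof (rule extensionalityI[OF satake_ext(2)[OF \<Phi> bM] restrict_extensional])
        fix l assume l: "l \<in> carrier F"
        have "S \<Phi> (b j) l = \<rho> (inv\<^bsub>G\<^esub> k) (S \<Phi> m (\<rho> (inv\<^bsub>G\<^esub> k') l))"
          unfolding bm using satake_equivariant[OF \<Phi> _ _ mM _ _ l] k by simp
        also have "\<dots> = \<rho> (inv\<^bsub>G\<^esub> k) \<zero>\<^bsub>D\<^esub>"
          using \<rho>_F_closed[OF _ _ l] k by (simp add: Sm)
        also have "\<dots> = \<zero>\<^bsub>D\<^esub>"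
          by (rule dual_ext) (use k in \<open>auto simp: \<rho>_apply dual_apply\<close>)
        finally show "S \<Phi> (b j) l = (\<lambda>l\<in>carrier F. \<zero>\<^bsub>D\<^esub>) l" using l by simp
      qed
      then show False using nz by simp
    qed
    then show "m \<in> A" using mM by (simp add: A_def)
  qed
  moreover have "finite B" using J(1) by (simp add: B_def)
  moreover have "B \<subseteq> M" using bA by (auto simp: B_def A'_def A_def)
  ultimately show thesis using that unfolding A_def by blast
qed

lemma satake_hecke: "S \<Phi> \<in> carrier (hecke_invariants C G K M N V \<pi>)"
proof -
  obtain B where B: "finite B" "B \<subseteq> M"
    "{m \<in> M. S \<Phi> m \<noteq> (\<lambda>l\<in>carrier F. \<zero>\<^bsub>D\<^esub>)} = (\<Union>m\<in>B. double_coset (G\<lparr>carrier := M\<rparr>) (M \<inter> K) m)"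
    by (rule satake_support)
  show ?thesis
    unfolding hecke_invariants_def
  proof (rule hecke_carrierI[where F = B])
    show "S \<Phi> \<in> extensional (carrier (G\<lparr>carrier := M\<rparr>))" using satake_ext(1)[OF \<Phi>] by simp
    show "S \<Phi> m \<in> lin_maps C F F" if "m \<in> carrier (G\<lparr>carrier := M\<rparr>)" for m
      using satake_lin[OF \<Phi>] that by simp
    show "{m \<in> carrier (G\<lparr>carrier := M\<rparr>). S \<Phi> m \<noteq> (\<lambda>l\<in>carrier F. \<zero>\<^bsub>F\<^esub>)}
        = (\<Union>m\<in>B. double_coset (G\<lparr>carrier := M\<rparr>) (M \<inter> K) m)"
      using B(3) by (simp add: F_simps)
    show "\<rho> y l \<in> carrier F" if "y \<in> M \<inter> K" "l \<in> carrier F" for y l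
      using \<rho>_F_closed that by simp
  qed (use B satake_equivariant[OF \<Phi>] in auto)
qed

text \<open>Left multiplication of \<open>n\<close> by \<open>h\<close> in \<open>H\<close> acts on
  the value by \<open>\<pi> h\<close>, which the passage to coinvariants erases; so the summand is
  constant on right cosets.\<close>

lemma coinvariant_summable:
  assumes m: "m \<in> M" and v: "v \<in> carrier V"
  shows "coset_summable Q (\<lambda>n. cl (\<Psi> (n \<otimes>\<^bsub>G\<^esub> m) v)) Y"
  unfolding coset_summable_def
proof
  let ?f = "\<lambda>n. cl (\<Psi> (n \<otimes>\<^bsub>G\<^esub> m) v)"
  have im: "?f ` (H #>\<^bsub>G\<^esub> n) = {?f n}" if n: "n \<in> N" for n
  proof -
    have "?f (h \<otimes>\<^bsub>G\<^esub> n) = ?f n" if h: "h \<in> H" for h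
    proof -
      let ?w = "\<Psi> (n \<otimes>\<^bsub>G\<^esub> m) v"
      have w: "?w \<in> carrier V" using iota_closed[OF \<Phi>] n m v by simp
      have "h \<otimes>\<^bsub>G\<^esub> n \<otimes>\<^bsub>G\<^esub> m = h \<otimes>\<^bsub>G\<^esub> (n \<otimes>\<^bsub>G\<^esub> m) \<otimes>\<^bsub>G\<^esub> \<one>\<^bsub>G\<^esub>"
        using h n m by (simp add: G.m_assoc)
      then have "\<Psi> (h \<otimes>\<^bsub>G\<^esub> n \<otimes>\<^bsub>G\<^esub> m) v = \<pi> h ?w"
        using iota_equivariant[OF \<Phi>, of h "n \<otimes>\<^bsub>G\<^esub> m" "\<one>\<^bsub>G\<^esub>" v] h n m v by (simp add: \<pi>_one)
      moreover have "cl (\<pi> h ?w) = cl ?w"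
        by (rule cl_eqI[OF _ w \<pi>_minus_U[OF h w]]) (use h w in auto)
      ultimately show ?thesis by simp
    qed
    then have "?f ` (H #>\<^bsub>G\<^esub> n) = (\<lambda>_. ?f n) ` (H #>\<^bsub>G\<^esub> n)"
      by (intro image_cong refl) (auto simp: r_coset_def)
    moreover have "n \<in> H #>\<^bsub>G\<^esub> n" using G.rcos_self[OF _ H_subgroup] n by simp
    ultimately show ?thesis by (simp add: image_constant)
  qed
  then show "\<forall>c\<in>Y. \<exists>w\<in>carrier Q. ?f ` c = {w}"
    using iota_closed[OF \<Phi>] m v by simp
  \<comment> \<open>\<open>\<Psi>\<close> at \<open>n m\<close> is the transpose of
    \<open>\<Phi>\<close> at the inverse of \<open>m\<close> times the inverse of \<open>n\<close>.
    Inverting cosets therefore embeds the support in question into \<open>?Z\<close>, already known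
    to be finite.\<close>
  let ?Z = "{c \<in> X. \<exists>n\<in>c. \<Phi> (inv\<^bsub>G\<^esub> m \<otimes>\<^bsub>G\<^esub> n) \<noteq> (\<lambda>l\<in>carrier D. \<zero>\<^bsub>D\<^esub>)}"
  have "finite ?Z" using finite_support_cosets[OF \<Phi>, of "inv\<^bsub>G\<^esub> m"] m by simp
  moreover have "(`) (\<lambda>n. inv\<^bsub>G\<^esub> n) ` {c \<in> Y. ?f ` c \<noteq> {\<zero>\<^bsub>Q\<^esub>}} \<subseteq> ?Z"
  proof (rule image_subsetI)
    fix c assume c: "c \<in> {c \<in> Y. ?f ` c \<noteq> {\<zero>\<^bsub>Q\<^esub>}}"
    then obtain n where n: "n \<in> N" "c = H #>\<^bsub>G\<^esub> n" by blast
    have "\<Psi> (n \<otimes>\<^bsub>G\<^esub> m) \<noteq> (\<lambda>v\<in>carrier V. \<zero>\<^bsub>V\<^esub>)"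
    proof
      assume "\<Psi> (n \<otimes>\<^bsub>G\<^esub> m) = (\<lambda>v\<in>carrier V. \<zero>\<^bsub>V\<^esub>)"
      then have "?f n = \<zero>\<^bsub>Q\<^esub>" using v by (simp add: cl_zero)
      then show False using c im[OF n(1)] n(2) by simp
    qed
    then have "\<Phi> (inv\<^bsub>G\<^esub> (n \<otimes>\<^bsub>G\<^esub> m)) \<noteq> (\<lambda>l\<in>carrier D. \<zero>\<^bsub>D\<^esub>)"
      using iota_zero_iff[OF \<Phi>, of "n \<otimes>\<^bsub>G\<^esub> m"] n m by simp
    then have "\<Phi> (inv\<^bsub>G\<^esub> m \<otimes>\<^bsub>G\<^esub> inv\<^bsub>G\<^esub> n) \<noteq> (\<lambda>l\<in>carrier D. \<zero>\<^bsub>D\<^esub>)"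
      using n m by (simp add: G.inv_mult_group)
    moreover have "inv\<^bsub>G\<^esub> n \<in> (\<lambda>n. inv\<^bsub>G\<^esub> n) ` c"
      using G.rcos_self[OF _ H_subgroup] n by simp
    moreover have "(\<lambda>n. inv\<^bsub>G\<^esub> n) ` c \<in> X"
      unfolding rcosets_inverse(2)[symmetric] by (rule imageI) (use c in simp)
    ultimately show "(\<lambda>n. inv\<^bsub>G\<^esub> n) ` c \<in> ?Z" by (intro CollectI conjI bexI)
  qed
  ultimately have "finite ((`) (\<lambda>n. inv\<^bsub>G\<^esub> n) ` {c \<in> Y. ?f ` c \<noteq> {\<zero>\<^bsub>Q\<^esub>}})"
    by (rule finite_subset[rotated])
  then show "finite {c \<in> Y. ?f ` c \<noteq> {\<zero>\<^bsub>Q\<^esub>}}"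
    by (rule finite_imageD) (rule inj_on_subset[OF rcosets_inverse(1)], simp)
qed

lemma coinvariant_sum_apply:
  assumes m: "m \<in> M" and v: "v \<in> carrier V" and l: "l \<in> carrier F"
  shows "e (coset_sum Q (\<lambda>n. cl (\<Psi> (n \<otimes>\<^bsub>G\<^esub> m) v)) Y) l = S \<Phi> (inv\<^bsub>G\<^esub> m) l v"
proof -
  let ?f = "\<lambda>n. \<Phi> (inv\<^bsub>G\<^esub> m \<otimes>\<^bsub>G\<^esub> n) l v"
  have m': "inv\<^bsub>G\<^esub> m \<in> M" using m by simp
  note summ = coset_sum_scalar[OF satake_summable[OF \<Phi> M_closed(1)[OF m'] l] v]
  have summ': "coset_summable (scalar_module C) (?f \<circ> (\<lambda>n. inv\<^bsub>G\<^esub> n)) Y"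
    using coset_summable_reindex[OF rcosets_inverse(1), of "scalar_module C" ?f] summ(2)
      rcosets_inverse(2) by simp
  \<comment> \<open>For fixed \<open>l\<close> the pairing with \<open>e\<close> is additive in
    \<open>Z\<close>, so it passes inside the sum and the terms become scalars before the cosets are
    inverted.\<close>
  let ?g = "(\<lambda>Z. e Z l) \<circ> (\<lambda>n. cl (\<Psi> (n \<otimes>\<^bsub>G\<^esub> m) v))"
  have h1: "(\<lambda>Z. e Z l) \<in> carrier Q \<rightarrow> carrier (scalar_module C)"
    using dualD(2)[OF F_D[OF l]] by (auto simp: Q_carrier e_apply[OF l])
  have h2: "e \<zero>\<^bsub>Q\<^esub> l = \<zero>\<^bsub>scalar_module C\<^esub>"
    by (simp add: e_apply[OF l] dual_vanish_zero[OF F_D[OF l]] flip: cl_zero)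
  have h3: "e (Z \<oplus>\<^bsub>Q\<^esub> Z') l = e Z l \<oplus>\<^bsub>scalar_module C\<^esub> e Z' l"
    if "Z \<in> carrier Q" "Z' \<in> carrier Q" for Z Z'
    using that by (auto simp: Q_carrier cl_add e_apply[OF l] dualD(3)[OF F_D[OF l]])
  note hom = additive_module.coset_sum_hom[OF Q_additive scalar_module_abelian_monoid h1 h2 h3
      coinvariant_summable[OF m v]]
  have "e (coset_sum Q (\<lambda>n. cl (\<Psi> (n \<otimes>\<^bsub>G\<^esub> m) v)) Y) l = coset_sum (scalar_module C) ?g Y"
    by (rule hom(2))
  also have "\<dots> = coset_sum (scalar_module C) (?f \<circ> (\<lambda>n. inv\<^bsub>G\<^esub> n)) Y"
  proof (rule additive_module.coset_sum_cong[OF additive_module.intro[OF scalar_module_abelian_monoid] hom(1)])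
    fix c n assume "c \<in> Y" "n \<in> c"
    then have "n \<in> N" using r_coset_N by blast
    then show "?g n = (?f \<circ> (\<lambda>n. inv\<^bsub>G\<^esub> n)) n"
      using m v l iota_apply[OF \<Phi> _ v F_D[OF l]] iota_closed[OF \<Phi>]
      by (simp add: e_apply G.inv_mult_group)
  qed
  also have "\<dots> = coset_sum (scalar_module C) ?f X"
    using additive_module.coset_sum_reindex[OF
        additive_module.intro[OF scalar_module_abelian_monoid] rcosets_inverse(1) summ']
    by (simp add: rcosets_inverse(2))
  also have "\<dots> = S \<Phi> (inv\<^bsub>G\<^esub> m) l v"
    unfolding satake_apply[OF \<Phi> m' l] by (rule summ(1)[symmetric])
  finally show ?thesis .
qed

lemma coinvariant_sum_closed:
  assumes "m \<in> M" "v \<in> carrier V"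
  shows "coset_sum Q (\<lambda>n. cl (\<Psi> (n \<otimes>\<^bsub>G\<^esub> m) v)) Y \<in> carrier Q"
  by (rule additive_module.coset_sum_closed[OF Q_additive coinvariant_summable[OF assms]])

text \<open>\<open>inv_into\<close> is evaluated at a point whose preimage is at hand: the transpose
  applied to \<open>e (cl v)\<close> is \<open>e\<close> of the coinvariant sum, and
  \<open>e\<close> is injective.\<close>

lemma iota_M_satake_apply:
  assumes m: "m \<in> M" and v: "v \<in> carrier V"
  shows "iota_M C G K M N V \<pi> (S \<Phi>) m (cl v) = coset_sum Q (\<lambda>n. cl (\<Psi> (n \<otimes>\<^bsub>G\<^esub> m) v)) Y"
proof -
  let ?s = "coset_sum Q (\<lambda>n. cl (\<Psi> (n \<otimes>\<^bsub>G\<^esub> m) v)) Y"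
  have m': "inv\<^bsub>G\<^esub> m \<in> M" "inv\<^bsub>G\<lparr>carrier := M\<rparr>\<^esub> m = inv\<^bsub>G\<^esub> m"
    using m G.m_inv_consistent[OF M m] by auto
  have "transpose_map C F (S \<Phi> (inv\<^bsub>G\<^esub> m)) (e (cl v)) = e ?s"
  proof (rule extensionalityI[of _ "carrier F"])
    show "transpose_map C F (S \<Phi> (inv\<^bsub>G\<^esub> m)) (e (cl v)) \<in> extensional (carrier F)"
      using e_closed[OF v] by (simp add: transpose_map_def)
    show "e ?s \<in> extensional (carrier F)" by (simp add: coinvariants_bidual_map_def)
    fix l assume l: "l \<in> carrier F"
    then show "transpose_map C F (S \<Phi> (inv\<^bsub>G\<^esub> m)) (e (cl v)) l = e ?s l"
      using e_closed[OF v] e_apply[OF satake_F_closed[OF \<Phi> m'(1) l] v]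
        coinvariant_sum_apply[OF m v l]
      by (simp add: transpose_map_def)
  qed
  then have "iota_M C G K M N V \<pi> (S \<Phi>) m (cl v) = inv_into (carrier Q) e (e ?s)"
    using satake_hecke m v m'(2) by (simp add: iota_M_def hecke_transpose_def)
  also have "\<dots> = ?s" by (rule inv_into_f_f[OF e_inj coinvariant_sum_closed[OF m v]])
  finally show ?thesis .
qed

text \<open>The \<open>the_elem\<close> in \<open>satake'\<close> needs the same sum for every
  representative \<open>u\<close> of the class. Under \<open>e\<close> the sums become values of a
  Satake transform of \<open>l\<close> at \<open>u\<close> and \<open>v\<close>, and these agree
  because that transform is again an invariant functional.\<close>

lemma satake'_iota_apply:
  assumes m: "m \<in> M" and v: "v \<in> carrier V"
  shows "satake' C G K M N V \<pi> \<Psi> m (cl v) = coset_sum Q (\<lambda>n. cl (\<Psi> (n \<otimes>\<^bsub>G\<^esub> m) v)) Y"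
proof -
  let ?s = "\<lambda>v. coset_sum Q (\<lambda>n. cl (\<Psi> (n \<otimes>\<^bsub>G\<^esub> m) v)) Y"
  have m': "inv\<^bsub>G\<^esub> m \<in> M" using m by simp
  have "?s u = ?s v" if "u \<in> cl v" for u
  proof (rule inj_onD[OF e_inj])
    note u = cl_memD[OF that v]
    show "?s u \<in> carrier Q" "?s v \<in> carrier Q"
      using coinvariant_sum_closed[OF m] u(1) v by auto
    show "e (?s u) = e (?s v)"
    proof (rule extensionalityI[of _ "carrier F"])
      fix l assume l: "l \<in> carrier F"
      have "S \<Phi> (inv\<^bsub>G\<^esub> m) l u = S \<Phi> (inv\<^bsub>G\<^esub> m) l v"
        using F_image_cl[OF satake_F_closed[OF \<Phi> m' l] v] that by blast
      then show "e (?s u) l = e (?s v) l"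
        using coinvariant_sum_apply[OF m u(1) l] coinvariant_sum_apply[OF m v l] by simp
    qed (simp_all add: coinvariants_bidual_map_def)
  qed
  then have "?s ` cl v = (\<lambda>_. ?s v) ` cl v" by (intro image_cong) auto
  then have "?s ` cl v = {?s v}" using cl_self[OF v] by (simp add: image_constant)
  then show ?thesis
    using iota_hecke[OF \<Phi>] m v by (simp add: satake'_def rcosets_N)
qed

theorem iota_M_satake: "iota_M C G K M N V \<pi> (S \<Phi>) = satake' C G K M N V \<pi> \<Psi>"
proof (rule extensionalityI[of _ M])
  show "iota_M C G K M N V \<pi> (S \<Phi>) \<in> extensional M"
    using satake_hecke by (simp add: iota_M_def hecke_transpose_def)
  show "satake' C G K M N V \<pi> \<Psi> \<in> extensional M"
    using iota_hecke[OF \<Phi>] by (simp add: satake'_def)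
  fix m assume m: "m \<in> M"
  show "iota_M C G K M N V \<pi> (S \<Phi>) m = satake' C G K M N V \<pi> \<Psi> m"
  proof (rule extensionalityI[of _ "carrier Q"])
    show "iota_M C G K M N V \<pi> (S \<Phi>) m \<in> extensional (carrier Q)"
      using satake_hecke m by (simp add: iota_M_def hecke_transpose_def)
    show "satake' C G K M N V \<pi> \<Psi> m \<in> extensional (carrier Q)"
      using iota_hecke[OF \<Phi>] m by (simp add: satake'_def)
    fix Z assume "Z \<in> carrier Q"
    then obtain v where "v \<in> carrier V" "Z = cl v" by (auto simp: Q_carrier)
    then show "iota_M C G K M N V \<pi> (S \<Phi>) m Z = satake' C G K M N V \<pi> \<Psi> m Z"
      using iota_M_satake_apply[OF m] satake'_iota_apply[OF m] by simp
  qed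
qed

end

end

theorem proposition2p4:
  fixes C :: "('c, 'r) ring_scheme"
    and G :: "('g, 'm) monoid_scheme"
    and T :: "'g topology"
    and K P N M :: "'g set"
    and V :: "('c, 'v, 'a) module_scheme"
    and \<pi> :: "'g \<Rightarrow> 'v \<Rightarrow> 'v"
  assumes "field C"
    and "locally_profinite_group G T"
    and "subgroup K G" "openin T K"
    and "subgroup P G" "closedin T P"
    and "carrier G = K <#>\<^bsub>G\<^esub> P"
    and "closedin T N" "closedin T M"
    and "semidirect_product G P N M"
    and "semidirect_product G (P \<inter> K) (N \<inter> K) (M \<inter> K)"
    and "\<forall>g\<in>carrier G. \<exists>F. finite F \<and> F \<subseteq> carrier G \<and>
           double_coset G K g = (\<Union>g'\<in>F. K #>\<^bsub>G\<^esub> g')"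
    and "\<forall>g\<in>carrier G. \<exists>F. finite F \<and> F \<subseteq> carrier G \<and>
           double_coset G K g = (\<Union>g''\<in>F. g'' <#\<^bsub>G\<^esub> K)"
    and "smooth_representation C G T K V \<pi>"
    and "vectorspace.fin_dim C V"
  shows "compose (carrier (hecke_dual C G K V \<pi>))
           (iota_M C G K M N V \<pi>) (satake C G K M N V \<pi>)
       = compose (carrier (hecke_dual C G K V \<pi>))
           (opposite_hom (hecke_algebra C G K V \<pi>) (satake' C G K M N V \<pi>)) (iota C G K V \<pi>)"
proof -
  have G: "group G"
    using assms(2) by (simp add: locally_profinite_group_def topological_group_def)
  interpret V: vectorspace C V
    using assms(14) by (simp add: smooth_representation_def)
  interpret satake_datum C V G K \<pi> P N M
  proof (intro satake_datum.intro finite_representation.intro finite_representation_axioms.intro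
      satake_datum_axioms.intro)
    show "group_action (G\<lparr>carrier := K\<rparr>) (carrier V) \<pi>" "\<And>k. k \<in> K \<Longrightarrow> \<pi> k \<in> lin_maps C V V"
      using assms(14) by (simp_all add: smooth_representation_def)
  qed (use assms(12,13) in \<open>simp_all add: assms G V.vectorspace_axioms\<close>)
  show ?thesis
    unfolding compose_def
  proof (rule restrict_ext)
    fix \<Phi> assume \<Phi>: "\<Phi> \<in> carrier (hecke_dual C G K V \<pi>)"
    \<comment> \<open>\<open>opposite_ring\<close> changes only the multiplication, so
      \<open>iota_hecke\<close> is exactly what allows the restriction in
      \<open>opposite_hom\<close> to be removed.\<close>
    then show "iota_M C G K M N V \<pi> (satake C G K M N V \<pi> \<Phi>)
        = opposite_hom (hecke_algebra C G K V \<pi>) (satake' C G K M N V \<pi>) (iota C G K V \<pi> \<Phi>)"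
      using iota_M_satake[OF \<Phi>] iota_hecke[OF \<Phi>]
      by (simp add: opposite_hom_def opposite_ring_def)
  qed
qed

end
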